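(* If $X$ is a topological stack (a stack in topological spaces admitting an atlas), then its loop stack $LX$ is a topological stack.
   Context: A stack in topological spaces is a stack of groupoids on the site of topological spaces with open coverings; spaces are stacks via Yoneda and fibre products are $2$-categorical. A map $X\to Y$ is representable if for every map $T\to Y$ from a space the fibre product $T\times_YX$ is equivalent to a space. An atlas of a stack $X$ is a map $A\to X$ from a topological space $A$ which is representable, surjective and admits local sections; a topological stack is a stack which admits an atlas. The loop stack $LX$ has as objects over a space $T$ the pairs $(u,\phi)$ with $u\in X(T)$ and $\phi\in\mathrm{Aut}(u)$, and as morphisms $(u,\phi)\to(u',\phi')$ the morphisms $k:u\to u'$ in $X(T)$ with $\phi'k=k\phi$. *)

theory Defs
  imports "HOL-Analysis.Abstract_Topology" "HOL-Library.FuncSet"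
begin

text \<open>
  The site consists of all topological spaces whose points lie in the type \<open>'a\<close>
  (a space is a term of type \<open>'a topology\<close>, its underlying set is an arbitrary subset of \<open>'a\<close>);
  \<open>'a\<close> plays the role of the universe, and everything below is polymorphic in it.
  A morphism of spaces is a continuous map, made unique as a HOL function by extensionality.
  Stacks are presented as categories fibred in groupoids over this site: the groupoid \<open>X(T)\<close>
  consists of the objects over \<open>T\<close> and the arrows over the identity of \<open>T\<close>.
\<close>

subsection \<open>Continuous maps\<close>

definition cmap :: "'a topology \<Rightarrow> 'a topology \<Rightarrow> ('a \<Rightarrow> 'a) set" where
  "cmap S T = {f. continuous_map S T f \<and> f \<in> extensional (topspace S)}"

definition idmap :: "'a topology \<Rightarrow> 'a \<Rightarrow> 'a" where
  "idmap T = (\<lambda>t\<in>topspace T. t)"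

definition admits_local_sections :: "'a topology \<Rightarrow> 'a topology \<Rightarrow> ('a \<Rightarrow> 'a) \<Rightarrow> bool" where
  "admits_local_sections P T p \<longleftrightarrow>
     (\<forall>t\<in>topspace T. \<exists>U s. openin T U \<and> t \<in> U \<and>
        continuous_map (subtopology T U) P s \<and> (\<forall>v\<in>U. p (s v) = v))"

definition open_cover :: "'a topology \<Rightarrow> 'a set set \<Rightarrow> bool" where
  "open_cover T \<U> \<longleftrightarrow> (\<forall>U\<in>\<U>. openin T U) \<and> \<Union>\<U> = topspace T"

subsection \<open>Categories over the category of spaces\<close>

text \<open>
  \<open>pObj\<close> and \<open>pMap\<close> are the object and arrow part of the projection to spaces; the image of
  an arrow \<open>k\<close> is \<open>pMap k\<close>, regarded as a map from \<open>pObj (Dom k)\<close> to \<open>pObj (Cod k)\<close>.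
  \<open>Comp X g f\<close> is the composite ``first \<open>f\<close>, then \<open>g\<close>''.
\<close>

record ('o, 'm, 'a) category_over =
  Obj :: "'o set"
  Arr :: "'m set"
  Dom :: "'m \<Rightarrow> 'o"
  Cod :: "'m \<Rightarrow> 'o"
  Id :: "'o \<Rightarrow> 'm"
  Comp :: "'m \<Rightarrow> 'm \<Rightarrow> 'm"
  pObj :: "'o \<Rightarrow> 'a topology"
  pMap :: "'m \<Rightarrow> 'a \<Rightarrow> 'a"

definition hom :: "('o, 'm, 'a) category_over \<Rightarrow> 'o \<Rightarrow> 'o \<Rightarrow> 'm set" where
  "hom X x y = {k \<in> Arr X. Dom X k = x \<and> Cod X k = y}"

text \<open>Morphisms and isomorphisms of the fibre categories \<open>X(T)\<close>.\<close>

definition vhom :: "('o, 'm, 'a) category_over \<Rightarrow> 'o \<Rightarrow> 'o \<Rightarrow> 'm set" where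
  "vhom X x y = {k \<in> hom X x y. pObj X x = pObj X y \<and> pMap X k = idmap (pObj X x)}"

definition viso :: "('o, 'm, 'a) category_over \<Rightarrow> 'o \<Rightarrow> 'o \<Rightarrow> 'm set" where
  "viso X x y = {k \<in> vhom X x y. \<exists>l\<in>vhom X y x. Comp X l k = Id X x \<and> Comp X k l = Id X y}"

locale category_over_spaces =
  fixes X :: "('o, 'm, 'a) category_over"
  assumes Dom_in: "k \<in> Arr X \<Longrightarrow> Dom X k \<in> Obj X"
    and Cod_in: "k \<in> Arr X \<Longrightarrow> Cod X k \<in> Obj X"
    and Id_in: "x \<in> Obj X \<Longrightarrow> Id X x \<in> hom X x x"
    and Comp_in: "f \<in> hom X x y \<Longrightarrow> g \<in> hom X y z \<Longrightarrow> Comp X g f \<in> hom X x z"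
    and Comp_Id_right: "f \<in> hom X x y \<Longrightarrow> Comp X f (Id X x) = f"
    and Comp_Id_left: "f \<in> hom X x y \<Longrightarrow> Comp X (Id X y) f = f"
    and Comp_assoc: "f \<in> hom X w x \<Longrightarrow> g \<in> hom X x y \<Longrightarrow> h \<in> hom X y z \<Longrightarrow>
      Comp X h (Comp X g f) = Comp X (Comp X h g) f"
    and pMap_in: "f \<in> hom X x y \<Longrightarrow> pMap X f \<in> cmap (pObj X x) (pObj X y)"
    and pMap_Id: "x \<in> Obj X \<Longrightarrow> pMap X (Id X x) = idmap (pObj X x)"
    and pMap_Comp: "f \<in> hom X x y \<Longrightarrow> g \<in> hom X y z \<Longrightarrow>
      pMap X (Comp X g f) = compose (topspace (pObj X x)) (pMap X g) (pMap X f)"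

locale fibred_in_groupoids = category_over_spaces X
  for X :: "('o, 'm, 'a) category_over" +
  assumes lift_ex: "y \<in> Obj X \<Longrightarrow> f \<in> cmap S (pObj X y) \<Longrightarrow>
      \<exists>x k. k \<in> hom X x y \<and> pObj X x = S \<and> pMap X k = f"
    and lift_unique: "k \<in> hom X x z \<Longrightarrow> l \<in> hom X y z \<Longrightarrow> f \<in> cmap (pObj X x) (pObj X y) \<Longrightarrow>
      pMap X k = compose (topspace (pObj X x)) (pMap X l) f \<Longrightarrow>
      \<exists>!h. h \<in> hom X x y \<and> pMap X h = f \<and> Comp X l h = k"

subsection \<open>Restriction to open subsets\<close>

text \<open>A chosen arrow \<open>x|V \<rightarrow> x\<close> over the inclusion of \<open>V\<close>.\<close>

definition res_arr :: "('o, 'm, 'a) category_over \<Rightarrow> 'o \<Rightarrow> 'a set \<Rightarrow> 'm" where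
  "res_arr X x V = (SOME k. k \<in> Arr X \<and> Cod X k = x \<and>
     pObj X (Dom X k) = subtopology (pObj X x) V \<and>
     pMap X k = idmap (subtopology (pObj X x) V))"

definition res :: "('o, 'm, 'a) category_over \<Rightarrow> 'o \<Rightarrow> 'a set \<Rightarrow> 'o" where
  "res X x V = Dom X (res_arr X x V)"

text \<open>The canonical arrow \<open>x|V \<rightarrow> x|W\<close> for \<open>V \<subseteq> W\<close>.\<close>

definition res_incl :: "('o, 'm, 'a) category_over \<Rightarrow> 'o \<Rightarrow> 'a set \<Rightarrow> 'a set \<Rightarrow> 'm" where
  "res_incl X x V W = (THE c. c \<in> hom X (res X x V) (res X x W) \<and>
     pMap X c = idmap (subtopology (pObj X x) V) \<and>
     Comp X (res_arr X x W) c = res_arr X x V)"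

text \<open>
  The base change \<open>x' \<rightarrow> y'\<close> of a vertical arrow \<open>k : x \<rightarrow> y\<close> along arrows \<open>a : x' \<rightarrow> x\<close> and
  \<open>b : y' \<rightarrow> y\<close> lying over the same map of spaces.
\<close>

definition base_change :: "('o, 'm, 'a) category_over \<Rightarrow> 'm \<Rightarrow> 'm \<Rightarrow> 'm \<Rightarrow> 'm" where
  "base_change X a b k = (THE l. l \<in> vhom X (Dom X a) (Dom X b) \<and> Comp X b l = Comp X k a)"

definition res_iso :: "('o, 'm, 'a) category_over \<Rightarrow> 'o \<Rightarrow> 'o \<Rightarrow> 'a set \<Rightarrow> 'a set \<Rightarrow> 'm \<Rightarrow> 'm" where
  "res_iso X x y V W k = base_change X (res_incl X x V W) (res_incl X y V W) k"
  \<comment> \<open>restricts \<open>k : x|W \<rightarrow> y|W\<close> to \<open>x|V \<rightarrow> y|V\<close>\<close>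

subsection \<open>Stacks\<close>

definition descent_datum ::
  "('o, 'm, 'a) category_over \<Rightarrow> 'a topology \<Rightarrow> 'a set set \<Rightarrow>
    ('a set \<Rightarrow> 'o) \<Rightarrow> ('a set \<Rightarrow> 'a set \<Rightarrow> 'm) \<Rightarrow> bool" where
  "descent_datum X T \<U> x \<phi> \<longleftrightarrow>
     (\<forall>U\<in>\<U>. x U \<in> Obj X \<and> pObj X (x U) = subtopology T U) \<and>
     (\<forall>U\<in>\<U>. \<forall>V\<in>\<U>. \<phi> U V \<in> viso X (res X (x U) (U \<inter> V)) (res X (x V) (U \<inter> V))) \<and>
     (\<forall>U\<in>\<U>. \<forall>V\<in>\<U>. \<forall>W\<in>\<U>.
        Comp X (res_iso X (x V) (x W) (U \<inter> V \<inter> W) (V \<inter> W) (\<phi> V W))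
               (res_iso X (x U) (x V) (U \<inter> V \<inter> W) (U \<inter> V) (\<phi> U V))
        = res_iso X (x U) (x W) (U \<inter> V \<inter> W) (U \<inter> W) (\<phi> U W))"

definition effective ::
  "('o, 'm, 'a) category_over \<Rightarrow> 'a topology \<Rightarrow> 'a set set \<Rightarrow>
    ('a set \<Rightarrow> 'o) \<Rightarrow> ('a set \<Rightarrow> 'a set \<Rightarrow> 'm) \<Rightarrow> bool" where
  "effective X T \<U> x \<phi> \<longleftrightarrow>
     (\<exists>z \<alpha>. z \<in> Obj X \<and> pObj X z = T \<and>
        (\<forall>U\<in>\<U>. \<alpha> U \<in> viso X (res X z U) (x U)) \<and>
        (\<forall>U\<in>\<U>. \<forall>V\<in>\<U>.
           Comp X (\<phi> U V)
             (base_change X (res_incl X z (U \<inter> V) U) (res_arr X (x U) (U \<inter> V)) (\<alpha> U))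
           = base_change X (res_incl X z (U \<inter> V) V) (res_arr X (x V) (U \<inter> V)) (\<alpha> V)))"

locale stack = fibred_in_groupoids X
  for X :: "('o, 'm, 'a) category_over" +
  assumes iso_sheaf:
    "open_cover T \<U> \<Longrightarrow> x \<in> Obj X \<Longrightarrow> y \<in> Obj X \<Longrightarrow> pObj X x = T \<Longrightarrow> pObj X y = T \<Longrightarrow>
     (\<And>U. U \<in> \<U> \<Longrightarrow> \<phi> U \<in> viso X (res X x U) (res X y U)) \<Longrightarrow>
     (\<And>U V. U \<in> \<U> \<Longrightarrow> V \<in> \<U> \<Longrightarrow>
        res_iso X x y (U \<inter> V) U (\<phi> U) = res_iso X x y (U \<inter> V) V (\<phi> V)) \<Longrightarrow>
     \<exists>!k. k \<in> viso X x y \<and> (\<forall>U\<in>\<U>. base_change X (res_arr X x U) (res_arr X y U) k = \<phi> U)"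
    and descent_effective:
    "open_cover T \<U> \<Longrightarrow> descent_datum X T \<U> x' \<phi>' \<Longrightarrow> effective X T \<U> x' \<phi>'"

subsection \<open>Maps, equivalences and fibre products\<close>

record ('o, 'm, 'p, 'n) cat_map =
  onObj :: "'o \<Rightarrow> 'p"
  onArr :: "'m \<Rightarrow> 'n"

definition is_map :: "('o, 'm, 'a) category_over \<Rightarrow> ('p, 'n, 'a) category_over \<Rightarrow>
    ('o, 'm, 'p, 'n) cat_map \<Rightarrow> bool" where
  "is_map X Y F \<longleftrightarrow>
     (\<forall>x\<in>Obj X. onObj F x \<in> Obj Y \<and> pObj Y (onObj F x) = pObj X x \<and>
        onArr F (Id X x) = Id Y (onObj F x)) \<and>
     (\<forall>x y. \<forall>k\<in>hom X x y. onArr F k \<in> hom Y (onObj F x) (onObj F y) \<and>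
        pMap Y (onArr F k) = pMap X k) \<and>
     (\<forall>x y z. \<forall>f\<in>hom X x y. \<forall>g\<in>hom X y z.
        onArr F (Comp X g f) = Comp Y (onArr F g) (onArr F f))"

definition id_map :: "('o, 'm, 'o, 'm) cat_map" where
  "id_map = \<lparr>onObj = (\<lambda>x. x), onArr = (\<lambda>k. k)\<rparr>"

definition comp_map :: "('p, 'n, 'q, 'l) cat_map \<Rightarrow> ('o, 'm, 'p, 'n) cat_map \<Rightarrow>
    ('o, 'm, 'q, 'l) cat_map" where
  "comp_map G F = \<lparr>onObj = onObj G \<circ> onObj F, onArr = onArr G \<circ> onArr F\<rparr>"

definition is_2iso :: "('o, 'm, 'a) category_over \<Rightarrow> ('p, 'n, 'a) category_over \<Rightarrow>
    ('o, 'm, 'p, 'n) cat_map \<Rightarrow> ('o, 'm, 'p, 'n) cat_map \<Rightarrow> ('o \<Rightarrow> 'n) \<Rightarrow> bool" where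
  "is_2iso X Y F G \<eta> \<longleftrightarrow>
     (\<forall>x\<in>Obj X. \<eta> x \<in> viso Y (onObj F x) (onObj G x)) \<and>
     (\<forall>x y. \<forall>k\<in>hom X x y. Comp Y (\<eta> y) (onArr F k) = Comp Y (onArr G k) (\<eta> x))"

definition is_equivalence :: "('o, 'm, 'a) category_over \<Rightarrow> ('p, 'n, 'a) category_over \<Rightarrow>
    ('o, 'm, 'p, 'n) cat_map \<Rightarrow> bool" where
  "is_equivalence X Y F \<longleftrightarrow> is_map X Y F \<and>
     (\<exists>G \<eta> \<epsilon>. is_map Y X G \<and>
        is_2iso X X (comp_map G F) id_map \<eta> \<and> is_2iso Y Y (comp_map F G) id_map \<epsilon>)"

text \<open>An arrow \<open>(y, z, \<phi>) \<rightarrow> (y', z', \<phi>')\<close> of the fibre product of \<open>F : Y \<rightarrow> X\<close> and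
  \<open>G : Z \<rightarrow> X\<close> is recorded together with its source and target.\<close>

definition fibre_product :: "('o, 'm, 'a) category_over \<Rightarrow>
    ('p, 'n, 'a) category_over \<Rightarrow> ('p, 'n, 'o, 'm) cat_map \<Rightarrow>
    ('q, 'l, 'a) category_over \<Rightarrow> ('q, 'l, 'o, 'm) cat_map \<Rightarrow>
    ('p \<times> 'q \<times> 'm, ('p \<times> 'q \<times> 'm) \<times> ('n \<times> 'l) \<times> ('p \<times> 'q \<times> 'm), 'a) category_over" where
  "fibre_product X Y F Z G =
    (let Ob = {(y, z, \<phi>). y \<in> Obj Y \<and> z \<in> Obj Z \<and> pObj Y y = pObj Z z \<and>
                 \<phi> \<in> viso X (onObj F y) (onObj G z)}
     in \<lparr>Obj = Ob,
         Arr = {((y, z, \<phi>), (h, k), (y', z', \<phi>')). (y, z, \<phi>) \<in> Ob \<and> (y', z', \<phi>') \<in> Ob \<and>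
                  h \<in> hom Y y y' \<and> k \<in> hom Z z z' \<and> pMap Y h = pMap Z k \<and>
                  Comp X (onArr G k) \<phi> = Comp X \<phi>' (onArr F h)},
         Dom = (\<lambda>(s, _, _). s),
         Cod = (\<lambda>(_, _, t). t),
         Id = (\<lambda>(y, z, \<phi>). ((y, z, \<phi>), (Id Y y, Id Z z), (y, z, \<phi>))),
         Comp = (\<lambda>(_, (h', k'), t) (s, (h, k), _). (s, (Comp Y h' h, Comp Z k' k), t)),
         pObj = (\<lambda>(y, _, _). pObj Y y),
         pMap = (\<lambda>(_, (h, _), _). pMap Y h)\<rparr>)"

definition proj1 ::
  "('p \<times> 'q \<times> 'm, ('p \<times> 'q \<times> 'm) \<times> ('n \<times> 'l) \<times> ('p \<times> 'q \<times> 'm), 'p, 'n) cat_map" where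
  "proj1 = \<lparr>onObj = (\<lambda>(y, _, _). y), onArr = (\<lambda>(_, (h, _), _). h)\<rparr>"

subsection \<open>Spaces as stacks\<close>

text \<open>The stack represented by \<open>T\<close>: objects over \<open>S\<close> are the maps \<open>a : S \<rightarrow> T\<close>, encoded as
  \<open>(S, a)\<close>; there are only identity arrows in the fibres.\<close>

type_synonym 'a yo_obj = "'a topology \<times> ('a \<Rightarrow> 'a)"
type_synonym 'a yo_arr = "'a yo_obj \<times> ('a \<Rightarrow> 'a) \<times> 'a yo_obj"

definition yoneda :: "'a topology \<Rightarrow> ('a yo_obj, 'a yo_arr, 'a) category_over" where
  "yoneda T =
     \<lparr>Obj = {(S, a). a \<in> cmap S T},
      Arr = {((S, a), f, (S', a')). a \<in> cmap S T \<and> a' \<in> cmap S' T \<and> f \<in> cmap S S' \<and>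
               a = compose (topspace S) a' f},
      Dom = (\<lambda>(s, _, _). s),
      Cod = (\<lambda>(_, _, t). t),
      Id = (\<lambda>(S, a). ((S, a), idmap S, (S, a))),
      Comp = (\<lambda>(_, g, t) (s, f, _). (s, compose (topspace (fst s)) g f, t)),
      pObj = fst,
      pMap = (\<lambda>(_, f, _). f)\<rparr>"

text \<open>The map of spaces \<open>P \<rightarrow> T\<close> given by a map of stacks \<open>yoneda P \<rightarrow> yoneda T\<close>:
  the image of the identity of \<open>P\<close>.\<close>

definition space_map :: "'a topology \<Rightarrow> ('a yo_obj, 'a yo_arr, 'a yo_obj, 'a yo_arr) cat_map \<Rightarrow>
    'a \<Rightarrow> 'a" where
  "space_map P H = snd (onObj H (P, idmap P))"

subsection \<open>Topological stacks\<close>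

definition representable :: "('o, 'm, 'a) category_over \<Rightarrow> ('p, 'n, 'a) category_over \<Rightarrow>
    ('o, 'm, 'p, 'n) cat_map \<Rightarrow> bool" where
  "representable X Y F \<longleftrightarrow> is_map X Y F \<and>
     (\<forall>T G. is_map (yoneda T) Y G \<longrightarrow>
        (\<exists>P E. is_equivalence (yoneda P) (fibre_product Y (yoneda T) G X F) E))"

text \<open>A property of maps of spaces is required of a representable map \<open>X \<rightarrow> Y\<close> by requiring it of
  all base changes \<open>P = T \<times>\<^sub>Y X \<rightarrow> T\<close> along maps \<open>T \<rightarrow> Y\<close> from spaces.\<close>

definition all_base_changes ::
  "('a topology \<Rightarrow> 'a topology \<Rightarrow> ('a \<Rightarrow> 'a) \<Rightarrow> bool) \<Rightarrow>
    ('o, 'm, 'a) category_over \<Rightarrow> ('p, 'n, 'a) category_over \<Rightarrow>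
    ('o, 'm, 'p, 'n) cat_map \<Rightarrow> bool" where
  "all_base_changes Q X Y F \<longleftrightarrow>
     (\<forall>T G P E. is_map (yoneda T) Y G \<longrightarrow>
        is_equivalence (yoneda P) (fibre_product Y (yoneda T) G X F) E \<longrightarrow>
        Q P T (space_map P (comp_map proj1 E)))"

definition is_atlas :: "('o, 'm, 'a) category_over \<Rightarrow> 'a topology \<Rightarrow>
    ('a yo_obj, 'a yo_arr, 'o, 'm) cat_map \<Rightarrow> bool" where
  "is_atlas X A F \<longleftrightarrow>
     representable (yoneda A) X F \<and>
     all_base_changes (\<lambda>P T p. p ` topspace P = topspace T) (yoneda A) X F \<and>
     all_base_changes admits_local_sections (yoneda A) X F"

definition topological_stack :: "('o, 'm, 'a) category_over \<Rightarrow> bool" where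
  "topological_stack X \<longleftrightarrow> stack X \<and> (\<exists>A F. is_atlas X A F)"

subsection \<open>The loop stack\<close>

text \<open>
  An arrow \<open>(u, \<phi>) \<rightarrow> (u', \<phi>')\<close> over an arbitrary map of spaces is an arrow \<open>k : u \<rightarrow> u'\<close>
  with \<open>\<phi>' k = k \<phi>\<close>; the arrows over the identity of \<open>T\<close> are those with \<open>k\<close> in \<open>X(T)\<close>,
  and the pullback of \<open>(u, \<phi>)\<close> is the pullback of \<open>u\<close> with the pulled back automorphism.
\<close>

definition loop_stack :: "('o, 'm, 'a) category_over \<Rightarrow>
    ('o \<times> 'm, ('o \<times> 'm) \<times> 'm \<times> ('o \<times> 'm), 'a) category_over" where
  "loop_stack X =
    (let Ob = {(u, \<phi>). u \<in> Obj X \<and> \<phi> \<in> viso X u u}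
     in \<lparr>Obj = Ob,
         Arr = {((u, \<phi>), k, (u', \<phi>')). (u, \<phi>) \<in> Ob \<and> (u', \<phi>') \<in> Ob \<and>
                  k \<in> hom X u u' \<and> Comp X \<phi>' k = Comp X k \<phi>},
         Dom = (\<lambda>(s, _, _). s),
         Cod = (\<lambda>(_, _, t). t),
         Id = (\<lambda>(u, \<phi>). ((u, \<phi>), Id X u, (u, \<phi>))),
         Comp = (\<lambda>(_, l, t) (s, k, _). (s, Comp X l k, t)),
         pObj = (\<lambda>(u, _). pObj X u),
         pMap = (\<lambda>(_, k, _). pMap X k)\<rparr>)"

end

theory Submission
  imports Defs
begin

text \<open>
  Let \<open>F : A \<rightarrow> X\<close> be an atlas and let \<open>P\<close> be the space representing \<open>A \<times>\<^sub>X A\<close>. A map \<open>S \<rightarrow> P\<close> is a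
  pair of maps \<open>a, b : S \<rightarrow> A\<close> with an isomorphism \<open>F a \<rightarrow> F b\<close>, so the maps into the subspace
  \<open>B\<close> of \<open>P\<close> on which the two projections to \<open>A\<close> agree are the maps \<open>a : S \<rightarrow> A\<close> with an automorphism
  of \<open>F a\<close>; this gives \<open>B \<rightarrow> LX\<close>. For \<open>T \<rightarrow> LX\<close> the automorphism over \<open>T\<close> determines, by conjugation,
  the one over \<open>B\<close>, hence \<open>T \<times>\<^bsub>LX\<^esub> B\<close> and \<open>T \<times>\<^sub>X A\<close> are isomorphic over \<open>T\<close>, and \<open>B \<rightarrow> LX\<close> inherits all
  properties of the atlas \<open>A \<rightarrow> X\<close>.

  Automorphisms glue because isomorphisms form a sheaf, hence \<open>LX\<close> is a stack. The restrictions chosen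
  in \<open>LX\<close> need not lie over those chosen in \<open>X\<close>, so both stack axioms are needed in a form
  that does not mention chosen restrictions.
\<close>

subsection \<open>Continuous maps and fibred categories\<close>

text \<open>The atlas conditions are 2-categorical, but they concern only fibre products of spaces
  over a stack. These are fibred in sets: a vertical arrow joins an object only to itself, and an
  arrow is determined by its ends and its base map. An equivalence between two such categories is
  therefore just a map that is bijective on objects, so that comparing the base changes of
  \<open>B\<close> and \<open>A\<close> amounts to a bijection of points. This bijection does not
  touch the component in \<open>T\<close>, which is why the atlas properties transfer without a look
  at what they say. Chosen restrictions are removed by one observation: every arrow of a category
  fibred in groupoids is cartesian, so arrows over the same map that end in a restricted object can
  be compared after composing into the unrestricted one, where the choice is no longer visible. The
  passage is needed in both directions, from the axioms for \<open>X\<close> to the choice-free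
  form, and from that form for \<open>LX\<close> back to the axioms.\<close>

lemma cmapI: "continuous_map S T f \<Longrightarrow> f \<in> extensional (topspace S) \<Longrightarrow> f \<in> cmap S T"
  by (simp add: cmap_def)

lemma cmap_topspace: "f \<in> cmap S T \<Longrightarrow> x \<in> topspace S \<Longrightarrow> f x \<in> topspace T"
  by (auto simp: cmap_def continuous_map_def Pi_iff)

lemma idmap_cmap: "idmap T \<in> cmap T T"
proof -
  have "continuous_map T T (idmap T)"
    by (rule continuous_map_eq[of _ _ id]) (auto simp: idmap_def)
  then show ?thesis by (simp add: cmap_def idmap_def)
qed

lemma compose_cmap:
  assumes "f \<in> cmap S T" "g \<in> cmap T U"
  shows "compose (topspace S) g f \<in> cmap S U"
proof -
  have "continuous_map S U (g \<circ> f)"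
    using assms by (auto simp: cmap_def intro: continuous_map_compose)
  then have "continuous_map S U (compose (topspace S) g f)"
    by (rule continuous_map_eq) (simp add: compose_def)
  then show ?thesis by (simp add: cmap_def compose_def)
qed

lemma compose_idmap_right: "f \<in> cmap S T \<Longrightarrow> compose (topspace S) f (idmap S) = f"
  by (auto simp: cmap_def compose_def idmap_def extensional_def fun_eq_iff)

lemma compose_idmap_left: "f \<in> cmap S T \<Longrightarrow> compose (topspace S) (idmap T) f = f"
  by (auto simp: cmap_def compose_def idmap_def extensional_def fun_eq_iff
      dest: continuous_map_funspace)

lemma compose_cmap_assoc:
  assumes "f \<in> cmap S T"
  shows "compose (topspace S) h (compose (topspace S) g f)
    = compose (topspace S) (compose (topspace T) h g) f"
  using cmap_topspace[OF assms] by (auto simp: compose_def fun_eq_iff)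

lemma compose_idmap_idmap:
  "idmap S \<in> cmap S T \<Longrightarrow> compose (topspace S) (idmap T) (idmap S) = idmap S"
  by (rule compose_idmap_left)

lemma idmap_subtopology: "V \<subseteq> W \<Longrightarrow> idmap (subtopology T V) \<in> cmap (subtopology T V) (subtopology T W)"
  by (rule cmapI, rule continuous_map_eq[of _ _ id])
     (auto simp: idmap_def continuous_map_in_subtopology continuous_map_from_subtopology)

lemma idmap_subtopology': "idmap (subtopology T V) \<in> cmap (subtopology T V) T"
  using idmap_subtopology[of V UNIV T] by simp

context category_over_spaces
begin

lemma hom_Obj: "k \<in> hom X x y \<Longrightarrow> x \<in> Obj X" "k \<in> hom X x y \<Longrightarrow> y \<in> Obj X"
  using Dom_in Cod_in by (auto simp: hom_def)

lemma vhom_hom: "k \<in> vhom X x y \<Longrightarrow> k \<in> hom X x y"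
  by (simp add: vhom_def)

text \<open>The axioms speak of \<open>hom\<close> sets with explicit ends, and the simplifier
  cannot guess the middle objects. In terms of \<open>Arr\<close>, \<open>Dom\<close> and
  \<open>Cod\<close> the side conditions are equations that it can solve, and composites are
  normalised by nesting to the right.\<close>

lemma Comp_Arr:
  assumes "f \<in> Arr X" "g \<in> Arr X" "Cod X f = Dom X g"
  shows "Comp X g f \<in> Arr X" "Dom X (Comp X g f) = Dom X f" "Cod X (Comp X g f) = Cod X g"
  using Comp_in[of f "Dom X f" "Cod X f" g "Cod X g"] assms by (auto simp: hom_def)

lemma Comp_assoc_Arr:
  assumes "f \<in> Arr X" "g \<in> Arr X" "h \<in> Arr X" "Cod X f = Dom X g" "Cod X g = Dom X h"
  shows "Comp X (Comp X h g) f = Comp X h (Comp X g f)"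
  using assms Comp_assoc[of f "Dom X f" "Cod X f" g "Cod X g" h "Cod X h"] by (auto simp: hom_def)

lemma Comp_Id_Arr:
  assumes "f \<in> Arr X"
  shows "Dom X f = x \<Longrightarrow> Comp X f (Id X x) = f" "Cod X f = y \<Longrightarrow> Comp X (Id X y) f = f"
  using assms Comp_Id_left[of f "Dom X f"] Comp_Id_right[of f _ "Cod X f"] by (auto simp: hom_def)

lemma Id_vhom: "x \<in> Obj X \<Longrightarrow> Id X x \<in> vhom X x x"
  by (simp add: vhom_def Id_in pMap_Id)

lemma Id_viso: "x \<in> Obj X \<Longrightarrow> Id X x \<in> viso X x x"
  using Id_vhom[of x] Comp_Id_left[OF Id_in] by (auto simp: viso_def)

lemma Comp_vhom: "f \<in> vhom X x y \<Longrightarrow> g \<in> vhom X y z \<Longrightarrow> Comp X g f \<in> vhom X x z"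
  by (auto simp: vhom_def Comp_in pMap_Comp[of f x y g z] compose_idmap_idmap idmap_cmap)

lemma pMap_Comp_vhom_left:
  assumes "f \<in> hom X x y" "g \<in> vhom X y z" shows "pMap X (Comp X g f) = pMap X f"
  using assms pMap_Comp[of f x y g z] compose_idmap_left pMap_in[of f x y]
  by (auto simp: vhom_def)

lemma pMap_Comp_vhom_right:
  assumes "f \<in> vhom X x y" "g \<in> hom X y z" shows "pMap X (Comp X g f) = pMap X g"
  using assms pMap_Comp[of f x y g z] compose_idmap_right pMap_in[of g y z]
  by (auto simp: vhom_def)

end

text \<open>Arrows over the inclusion of a subspace.\<close>

definition ihom :: "('o, 'm, 'a) category_over \<Rightarrow> 'o \<Rightarrow> 'o \<Rightarrow> 'm set" where
  "ihom X x y = {k \<in> hom X x y. pMap X k = idmap (pObj X x)}"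

lemma vhom_iff_ihom: "k \<in> vhom X x y \<longleftrightarrow> k \<in> ihom X x y \<and> pObj X x = pObj X y"
  by (auto simp: vhom_def ihom_def)

section \<open>Cartesian arrows: lifting, cancellation and the chosen restrictions\<close>

context fibred_in_groupoids
begin

text \<open>This is the uniqueness half of \<open>lift_unique\<close>, applied to the common
  composite.\<close>

lemma hom_cancel:
  assumes "h \<in> hom X x y" "h' \<in> hom X x y" "l \<in> hom X y z" "pMap X h = pMap X h'"
    "Comp X l h = Comp X l h'"
  shows "h = h'"
proof -
  have "\<exists>!g. g \<in> hom X x y \<and> pMap X g = pMap X h \<and> Comp X l g = Comp X l h"
    by (rule lift_unique[of _ x z])
       (use assms in \<open>auto intro: Comp_in pMap_in pMap_Comp\<close>)
  then show ?thesis using assms by metis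
qed

lemma ihom_Comp:
  assumes "f \<in> ihom X x y" "g \<in> ihom X y z" shows "Comp X g f \<in> ihom X x z"
  using assms Comp_in[of f x y g z] pMap_Comp[of f x y g z] pMap_in[of f x y]
  by (auto simp: ihom_def compose_idmap_idmap)

lemma ihom_cancel:
  assumes "h \<in> ihom X x y" "h' \<in> ihom X x y" "l \<in> hom X y z" "Comp X l h = Comp X l h'"
  shows "h = h'"
  using assms hom_cancel[of h x y h' l z] by (auto simp: ihom_def)

text \<open>\<open>lift_unique\<close> for inclusions: the last hypothesis is the factorisation of
  the underlying inclusions that the lift has to cover.\<close>

lemma ihom_lift:
  assumes "k \<in> ihom X x z" "l \<in> ihom X y z" "idmap (pObj X x) \<in> cmap (pObj X x) (pObj X y)"
  shows "\<exists>!h. h \<in> ihom X x y \<and> Comp X l h = k"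
proof -
  have "\<exists>!h. h \<in> hom X x y \<and> pMap X h = idmap (pObj X x) \<and> Comp X l h = k"
    by (rule lift_unique[of _ x z])
       (use assms in \<open>auto simp: ihom_def compose_idmap_idmap\<close>)
  then show ?thesis by (auto simp: ihom_def)
qed

lemma vhom_lift:
  assumes "k \<in> hom X x z" "l \<in> hom X y z" "pObj X x = pObj X y" "pMap X k = pMap X l"
  shows "\<exists>!h. h \<in> vhom X x y \<and> Comp X l h = k"
proof -
  have "\<exists>!h. h \<in> hom X x y \<and> pMap X h = idmap (pObj X x) \<and> Comp X l h = k"
    by (rule lift_unique[of _ x z])
       (use assms pMap_in[of l y z] in \<open>auto simp: compose_idmap_right idmap_cmap\<close>)
  then show ?thesis using assms by (auto simp: vhom_def)
qed

text \<open>Lifting \<open>Id X y\<close> through \<open>k\<close> gives a right inverse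
  \<open>l\<close>. Since \<open>k l k = k\<close> and \<open>k\<close> cancels on the left,
  \<open>l\<close> is a left inverse too.\<close>

lemma viso_eq_vhom: "viso X x y = vhom X x y"
proof (intro set_eqI iffI)
  fix k assume k: "k \<in> vhom X x y"
  then have kh: "k \<in> hom X x y" "pObj X x = pObj X y" "pMap X k = idmap (pObj X x)"
    by (auto simp: vhom_def)
  have yO: "y \<in> Obj X" and xO: "x \<in> Obj X" using kh hom_Obj by auto
  obtain l where l: "l \<in> vhom X y x" "Comp X k l = Id X y"
    using vhom_lift[OF Id_in[OF yO] kh(1)] kh pMap_Id[OF yO] by auto
  have "Comp X k (Comp X l k) = Comp X k (Id X x)"
    using Comp_assoc[OF kh(1) vhom_hom[OF l(1)] kh(1)] l(2)
    by (simp add: Comp_Id_left[OF kh(1)] Comp_Id_right[OF kh(1)])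
  then have "Comp X l k = Id X x"
    using ihom_cancel[of "Comp X l k" x x "Id X x" k y] Comp_vhom[OF k l(1)] Id_vhom[OF xO] kh
    by (simp add: vhom_iff_ihom)
  then show "k \<in> viso X x y" using k l by (auto simp: viso_def)
qed (simp add: viso_def)

end

lemmas arrow_defs = hom_def ihom_def vhom_def

context fibred_in_groupoids
begin

lemmas Comp_simps = Comp_Arr Comp_assoc_Arr Comp_Id_Arr

lemma vhom_inverse:
  assumes "k \<in> vhom X x y"
  obtains l where "l \<in> vhom X y x" "Comp X l k = Id X x" "Comp X k l = Id X y"
proof -
  have "k \<in> viso X x y" using assms by (simp add: viso_eq_vhom)
  then show ?thesis using that by (auto simp: viso_def)
qed

text \<open>Cartesian arrows cancel on the left; a vertical arrow is moreover invertible and so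
  cancels on the right.\<close>

lemma vhom_cancel_right:
  assumes "k \<in> vhom X x y" "f \<in> hom X y z" "g \<in> hom X y z'" "Comp X f k = Comp X g k"
  shows "f = g"
proof -
  obtain l where l: "l \<in> vhom X y x" "Comp X k l = Id X y"
    using vhom_inverse[OF assms(1)] by metis
  have "Comp X (Comp X f k) l = Comp X (Comp X g k) l" using assms by simp
  then show ?thesis using assms(1-3) l by (simp add: arrow_defs Comp_simps)
qed

lemma res_arr_spec:
  assumes "x \<in> Obj X"
  shows "res_arr X x V \<in> ihom X (res X x V) x" "pObj X (res X x V) = subtopology (pObj X x) V"
proof -
  have "\<exists>k. k \<in> Arr X \<and> Cod X k = x \<and> pObj X (Dom X k) = subtopology (pObj X x) V \<and>
     pMap X k = idmap (subtopology (pObj X x) V)"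
    using lift_ex[OF assms idmap_subtopology'[of "pObj X x" V]] by (fastforce simp: hom_def)
  from someI_ex[OF this] show "res_arr X x V \<in> ihom X (res X x V) x"
    "pObj X (res X x V) = subtopology (pObj X x) V"
    by (auto simp: arrow_defs res_arr_def[symmetric] res_def)
qed

text \<open>The unique lift of one restriction arrow through the other justifies the
  \<open>THE\<close> in \<open>res_incl\<close>.\<close>

lemma res_incl_spec:
  assumes "x \<in> Obj X" "V \<subseteq> W"
  shows "res_incl X x V W \<in> ihom X (res X x V) (res X x W)"
    "Comp X (res_arr X x W) (res_incl X x V W) = res_arr X x V"
proof -
  have "\<exists>!c. c \<in> ihom X (res X x V) (res X x W) \<and> Comp X (res_arr X x W) c = res_arr X x V"
    by (rule ihom_lift[of _ _ x]) (use assms in \<open>auto simp: res_arr_spec idmap_subtopology\<close>)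
  then have "\<exists>!c. c \<in> hom X (res X x V) (res X x W) \<and>
     pMap X c = idmap (subtopology (pObj X x) V) \<and>
     Comp X (res_arr X x W) c = res_arr X x V"
    using assms by (simp add: ihom_def res_arr_spec)
  from theI'[OF this] show "res_incl X x V W \<in> ihom X (res X x V) (res X x W)"
    "Comp X (res_arr X x W) (res_incl X x V W) = res_arr X x V"
    using assms by (auto simp: ihom_def res_arr_spec res_incl_def[symmetric])
qed

lemma base_change_ex1:
  assumes "a \<in> hom X x' x" "b \<in> hom X y' y" "k \<in> vhom X x y" "pMap X a = pMap X b"
    "pObj X x' = pObj X y'"
  shows "\<exists>!l. l \<in> vhom X (Dom X a) (Dom X b) \<and> Comp X b l = Comp X k a"
proof -
  have "\<exists>!l. l \<in> vhom X x' y' \<and> Comp X b l = Comp X k a"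
    by (rule vhom_lift[of _ _ y])
       (use assms pMap_Comp_vhom_left[of a x' x k y] in \<open>auto intro: Comp_in vhom_hom\<close>)
  then show ?thesis using assms(1,2) by (simp add: hom_def)
qed

lemma base_change_spec:
  assumes "a \<in> hom X x' x" "b \<in> hom X y' y" "k \<in> vhom X x y" "pMap X a = pMap X b"
    "pObj X x' = pObj X y'"
  shows "base_change X a b k \<in> vhom X x' y'" "Comp X b (base_change X a b k) = Comp X k a"
  using theI'[OF base_change_ex1[OF assms]] assms(1,2)
  by (simp_all add: base_change_def hom_def)

text \<open>The defining square has a unique vertical solution, so a candidate need only be tested
  against the square. Equations with a chosen \<open>base_change\<close> become equations between
  composites in this way.\<close>

lemma base_change_eq_iff:
  assumes "a \<in> hom X x' x" "b \<in> hom X y' y" "k \<in> vhom X x y" "pMap X a = pMap X b"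
    "l \<in> vhom X x' y'"
  shows "base_change X a b k = l \<longleftrightarrow> Comp X b l = Comp X k a"
proof -
  have p: "pObj X x' = pObj X y'" using assms(5) by (simp add: vhom_def)
  show ?thesis
    using base_change_ex1[OF assms(1-4) p] base_change_spec[OF assms(1-4) p] assms(1,2,5)
    by (auto simp: hom_def)
qed

text \<open>Composing the base change square with \<open>res_arr X y W\<close> absorbs the inclusion
  on the side of \<open>y\<close>, and only restrictions of \<open>x\<close> remain next to
  \<open>k\<close>.\<close>

lemma res_iso_spec:
  assumes "x \<in> Obj X" "y \<in> Obj X" "pObj X (res X x V) = pObj X (res X y V)" "V \<subseteq> W"
    and k: "k \<in> vhom X (res X x W) (res X y W)"
  shows "res_iso X x y V W k \<in> vhom X (res X x V) (res X y V)"
    "Comp X (res_arr X y V) (res_iso X x y V W k) =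
       Comp X (res_arr X y W) (Comp X k (res_incl X x V W))"
proof -
  note x = res_arr_spec(1)[OF assms(1)] res_incl_spec[OF assms(1,4)]
  note y = res_arr_spec(1)[OF assms(2)] res_incl_spec[OF assms(2,4)]
  note * = base_change_spec[of "res_incl X x V W" "res X x V" "res X x W"
      "res_incl X y V W" "res X y V" "res X y W" k, folded res_iso_def]
  show l: "res_iso X x y V W k \<in> vhom X (res X x V) (res X y V)"
    by (rule *(1)) (use assms x y in \<open>auto simp: ihom_def\<close>)
  have e: "Comp X (res_incl X y V W) (res_iso X x y V W k) = Comp X k (res_incl X x V W)"
    by (rule *(2)) (use assms x y in \<open>auto simp: ihom_def\<close>)
  have "Comp X (res_arr X y V) (res_iso X x y V W k) =
    Comp X (Comp X (res_arr X y W) (res_incl X y V W)) (res_iso X x y V W k)"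
    using y by simp
  also have "\<dots> = Comp X (res_arr X y W) (Comp X (res_incl X y V W) (res_iso X x y V W k))"
    by (rule Comp_assoc_Arr) (use y l in \<open>auto simp: arrow_defs\<close>)
  finally show "Comp X (res_arr X y V) (res_iso X x y V W k) =
       Comp X (res_arr X y W) (Comp X k (res_incl X x V W))"
    by (simp add: e)
qed

end

subsection \<open>Gluing without chosen restrictions\<close>

text \<open>The sheaf property of isomorphisms, with an arbitrary restriction
  \<open>\<rho> U\<close> of \<open>x\<close> in place of \<open>res_arr\<close> and with local
  arrows that go straight into \<open>y\<close>, so that no restriction of \<open>y\<close> occurs.
  Agreement on an overlap is tested by all objects \<open>w\<close> over it whose arrows to the two
  pieces agree in \<open>x\<close>. Vertical arrows may replace isomorphisms by
  \<open>viso_eq_vhom\<close>.\<close>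

definition glues_arrows :: "('o, 'm, 'a) category_over \<Rightarrow> bool" where
  "glues_arrows X \<longleftrightarrow> (\<forall>T \<U> x y u \<rho> \<psi>. open_cover T \<U> \<longrightarrow> x \<in> Obj X \<longrightarrow> y \<in> Obj X \<longrightarrow>
     pObj X x = T \<longrightarrow> pObj X y = T \<longrightarrow>
     (\<forall>U\<in>\<U>. pObj X (u U) = subtopology T U \<and> \<rho> U \<in> ihom X (u U) x \<and> \<psi> U \<in> ihom X (u U) y) \<longrightarrow>
     (\<forall>U\<in>\<U>. \<forall>V\<in>\<U>. \<forall>w. \<forall>a\<in>ihom X w (u U). \<forall>b\<in>ihom X w (u V). pObj X w = subtopology T (U \<inter> V) \<longrightarrow>
        Comp X (\<rho> U) a = Comp X (\<rho> V) b \<longrightarrow> Comp X (\<psi> U) a = Comp X (\<psi> V) b) \<longrightarrow>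
     (\<exists>!k. k \<in> vhom X x y \<and> (\<forall>U\<in>\<U>. Comp X k (\<rho> U) = \<psi> U)))"

lemma open_cover_subset: "open_cover T \<U> \<Longrightarrow> U \<in> \<U> \<Longrightarrow> U \<subseteq> topspace T"
  by (auto simp: open_cover_def)

text \<open>An arbitrary restriction differs from the chosen one by an invertible arrow
  \<open>c U\<close>. Transport along it yields a family to which \<open>iso_sheaf\<close> applies,
  and cancelling \<open>c U\<close> carries the answer back.\<close>

lemma (in stack) glues_arrows: "glues_arrows X"
  unfolding glues_arrows_def
proof (intro allI impI)
  fix T \<U> x y u \<rho> \<psi>
  assume cover: "open_cover T \<U>" and xy: "x \<in> Obj X" "y \<in> Obj X" "pObj X x = T" "pObj X y = T"
    and u: "\<forall>U\<in>\<U>. pObj X (u U) = subtopology T U \<and> \<rho> U \<in> ihom X (u U) x \<and> \<psi> U \<in> ihom X (u U) y"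
    and compat: "\<forall>U\<in>\<U>. \<forall>V\<in>\<U>. \<forall>w. \<forall>a\<in>ihom X w (u U). \<forall>b\<in>ihom X w (u V).
      pObj X w = subtopology T (U \<inter> V) \<longrightarrow>
        Comp X (\<rho> U) a = Comp X (\<rho> V) b \<longrightarrow> Comp X (\<psi> U) a = Comp X (\<psi> V) b"
  note rx = res_arr_spec[OF xy(1), unfolded xy] and ry = res_arr_spec[OF xy(2), unfolded xy]
  have "\<exists>c\<in>vhom X (res X x U) (u U). Comp X (\<rho> U) c = res_arr X x U" if "U \<in> \<U>" for U
    using vhom_lift[of "res_arr X x U" "res X x U" x "\<rho> U" "u U"] rx u that
    by (auto simp: ihom_def)
  then obtain c where c: "\<And>U. U \<in> \<U> \<Longrightarrow> c U \<in> vhom X (res X x U) (u U)"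
    "\<And>U. U \<in> \<U> \<Longrightarrow> Comp X (\<rho> U) (c U) = res_arr X x U" by metis
  \<comment> \<open>The transported arrow ends in \<open>y\<close>; its factor through the chosen
    restriction of \<open>y\<close> is the local isomorphism that \<open>iso_sheaf\<close>
    expects.\<close>
  have "\<exists>p\<in>vhom X (res X x U) (res X y U). Comp X (res_arr X y U) p = Comp X (\<psi> U) (c U)"
    if U: "U \<in> \<U>" for U
  proof -
    have "Comp X (\<psi> U) (c U) \<in> ihom X (res X x U) y"
      using c(1)[OF U] u U ihom_Comp by (auto simp: vhom_iff_ihom)
    then show ?thesis
      using vhom_lift[of "Comp X (\<psi> U) (c U)" "res X x U" y "res_arr X y U" "res X y U"] rx ry
      by (auto simp: ihom_def)
  qed
  then obtain p where p: "\<And>U. U \<in> \<U> \<Longrightarrow> p U \<in> vhom X (res X x U) (res X y U)"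
    "\<And>U. U \<in> \<U> \<Longrightarrow> Comp X (res_arr X y U) (p U) = Comp X (\<psi> U) (c U)" by metis
  have pc: "res_iso X x y (U \<inter> V) U (p U) = res_iso X x y (U \<inter> V) V (p V)"
    if UV: "U \<in> \<U>" "V \<in> \<U>" for U V
  proof -
    let ?w = "res X x (U \<inter> V)"
    let ?a = "\<lambda>W. Comp X (c W) (res_incl X x (U \<inter> V) W)"
    have W: "?a W \<in> ihom X ?w (u W) \<and> Comp X (\<rho> W) (?a W) = res_arr X x (U \<inter> V) \<and>
      res_iso X x y (U \<inter> V) W (p W) \<in> vhom X ?w (res X y (U \<inter> V)) \<and>
      Comp X (res_arr X y (U \<inter> V)) (res_iso X x y (U \<inter> V) W (p W)) = Comp X (\<psi> W) (?a W)"
      if W: "W \<in> \<U>" "U \<inter> V \<subseteq> W" for W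
    proof (intro conjI)
      note i = res_incl_spec[OF xy(1) W(2)]
      note r = res_iso_spec[OF xy(1,2) _ W(2) p(1)[OF W(1)]]
      show "?a W \<in> ihom X ?w (u W)"
        using i c[OF W(1)] ihom_Comp by (auto simp: vhom_iff_ihom)
      have "Comp X (\<rho> W) (?a W) = Comp X (Comp X (\<rho> W) (c W)) (res_incl X x (U \<inter> V) W)"
        using i(1) c(1)[OF W(1)] u W(1) by (simp add: arrow_defs Comp_simps)
      then show "Comp X (\<rho> W) (?a W) = res_arr X x (U \<inter> V)"
        using i c W by simp
      show "res_iso X x y (U \<inter> V) W (p W) \<in> vhom X ?w (res X y (U \<inter> V))"
        by (rule r) (simp add: rx ry)
      have "Comp X (res_arr X y (U \<inter> V)) (res_iso X x y (U \<inter> V) W (p W))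
        = Comp X (res_arr X y W) (Comp X (p W) (res_incl X x (U \<inter> V) W))"
        by (rule r) (simp add: rx ry)
      also have "\<dots> = Comp X (Comp X (res_arr X y W) (p W)) (res_incl X x (U \<inter> V) W)"
        using i(1) ry(1)[of W] p(1)[OF W(1)] by (simp add: arrow_defs Comp_simps)
      also have "\<dots> = Comp X (\<psi> W) (?a W)"
        using p(2)[OF W(1)] i(1) c(1)[OF W(1)] u W(1) by (simp add: arrow_defs Comp_simps)
      finally show "Comp X (res_arr X y (U \<inter> V)) (res_iso X x y (U \<inter> V) W (p W)) = Comp X (\<psi> W) (?a W)" .
    qed
    \<comment> \<open>\<open>?a U\<close> and \<open>?a V\<close> have the same composite into
      \<open>x\<close>, so the chosen restriction of \<open>x\<close> to the overlap is an
      admissible test object.\<close>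
    have "Comp X (\<psi> U) (?a U) = Comp X (\<psi> V) (?a V)"
      using compat UV W[of U] W[of V] rx(2)[of "U \<inter> V"] by auto
    then have e: "Comp X (res_arr X y (U \<inter> V)) (res_iso X x y (U \<inter> V) U (p U)) =
      Comp X (res_arr X y (U \<inter> V)) (res_iso X x y (U \<inter> V) V (p V))"
      using W[of U] W[of V] UV by simp
    show ?thesis
      by (rule ihom_cancel[where x = ?w and y = "res X y (U \<inter> V)" and z = y, OF _ _ _ e])
         (use W[of U] W[of V] UV ry(1)[of "U \<inter> V"] in \<open>simp_all add: vhom_iff_ihom ihom_def\<close>)
  qed
  have "\<exists>!k. k \<in> viso X x y \<and> (\<forall>U\<in>\<U>. base_change X (res_arr X x U) (res_arr X y U) k = p U)"
    by (rule iso_sheaf[OF cover xy]) (simp add: viso_eq_vhom p, erule (1) pc)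
  \<comment> \<open>Composing with the cartesian arrow into \<open>y\<close> and then cancelling
    \<open>c U\<close> makes the chosen base change disappear.\<close>
  moreover have "base_change X (res_arr X x U) (res_arr X y U) k = p U \<longleftrightarrow> Comp X k (\<rho> U) = \<psi> U"
    if U: "U \<in> \<U>" and k: "k \<in> vhom X x y" for U k
  proof -
    have "base_change X (res_arr X x U) (res_arr X y U) k = p U
      \<longleftrightarrow> Comp X (res_arr X y U) (p U) = Comp X k (res_arr X x U)"
      by (rule base_change_eq_iff[OF _ _ k _ p(1)[OF U]])
         (use rx[of U] ry[of U] in \<open>auto simp: ihom_def\<close>)
    also have "\<dots> \<longleftrightarrow> Comp X (\<psi> U) (c U) = Comp X (Comp X k (\<rho> U)) (c U)"
      unfolding p(2)[OF U] c(2)[OF U, symmetric]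
      using k c(1)[OF U] u U by (simp add: arrow_defs Comp_simps)
    also have "\<dots> \<longleftrightarrow> Comp X k (\<rho> U) = \<psi> U"
      using vhom_cancel_right[OF c(1)[OF U], of "\<psi> U" y "Comp X k (\<rho> U)" y] u U k
      by (auto simp: arrow_defs Comp_simps)
    finally show ?thesis .
  qed
  ultimately show "\<exists>!k. k \<in> vhom X x y \<and> (\<forall>U\<in>\<U>. Comp X k (\<rho> U) = \<psi> U)"
    by (simp add: viso_eq_vhom cong: conj_cong)
qed

context fibred_in_groupoids
begin

text \<open>The way back to the axiom: the chosen restrictions are one admissible family
  \<open>\<rho>\<close>. It is meant for the loop stack.\<close>

lemma glues_arrows_imp_iso_sheaf:
  assumes glue: "glues_arrows X"
    and cover: "open_cover T \<U>" and xy: "x \<in> Obj X" "y \<in> Obj X" "pObj X x = T" "pObj X y = T"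
    and p: "\<And>U. U \<in> \<U> \<Longrightarrow> \<phi> U \<in> viso X (res X x U) (res X y U)"
    and pc: "\<And>U V. U \<in> \<U> \<Longrightarrow> V \<in> \<U> \<Longrightarrow>
        res_iso X x y (U \<inter> V) U (\<phi> U) = res_iso X x y (U \<inter> V) V (\<phi> V)"
  shows "\<exists>!k. k \<in> viso X x y \<and> (\<forall>U\<in>\<U>. base_change X (res_arr X x U) (res_arr X y U) k = \<phi> U)"
proof -
  note rx = res_arr_spec[OF xy(1), unfolded xy] and ry = res_arr_spec[OF xy(2), unfolded xy]
  note p = p[unfolded viso_eq_vhom]
  let ?\<psi> = "\<lambda>U. Comp X (res_arr X y U) (\<phi> U)"
  have compat: "Comp X (?\<psi> U) a = Comp X (?\<psi> V) b"
    if UV: "U \<in> \<U>" "V \<in> \<U>" and ab: "a \<in> ihom X w (res X x U)" "b \<in> ihom X w (res X x V)"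
      and w: "pObj X w = subtopology T (U \<inter> V)"
      and e: "Comp X (res_arr X x U) a = Comp X (res_arr X x V) b" for U V w a b
  proof -
    \<comment> \<open>Every test object over the overlap factors through the chosen restriction by
      some \<open>m\<close>, so the agreement \<open>pc\<close> there implies agreement on all of
      them.\<close>
    have "Comp X (res_arr X x U) a \<in> ihom X w x" using ihom_Comp[OF ab(1)] rx by simp
    then obtain m where m: "m \<in> ihom X w (res X x (U \<inter> V))"
      "Comp X (res_arr X x (U \<inter> V)) m = Comp X (res_arr X x U) a"
      using ihom_lift[of "Comp X (res_arr X x U) a" w x "res_arr X x (U \<inter> V)" "res X x (U \<inter> V)"]
        rx w idmap_cmap by metis
    have "Comp X (?\<psi> W) d = Comp X (res_arr X y (U \<inter> V)) (Comp X (res_iso X x y (U \<inter> V) W (\<phi> W)) m)"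
      if W: "W \<in> \<U>" "U \<inter> V \<subseteq> W" and d: "d \<in> ihom X w (res X x W)"
        "Comp X (res_arr X x W) d = Comp X (res_arr X x (U \<inter> V)) m" for W d
    proof -
      note i = res_incl_spec[OF xy(1) W(2)]
      note r = res_iso_spec[OF xy(1,2) _ W(2) p[OF W(1)]]
      have r1: "res_iso X x y (U \<inter> V) W (\<phi> W) \<in> vhom X (res X x (U \<inter> V)) (res X y (U \<inter> V))"
        by (rule r) (simp add: rx ry)
      have r2: "Comp X (res_arr X y (U \<inter> V)) (res_iso X x y (U \<inter> V) W (\<phi> W)) =
         Comp X (res_arr X y W) (Comp X (\<phi> W) (res_incl X x (U \<inter> V) W))"
        by (rule r) (simp add: rx ry)
      have "Comp X (res_arr X x W) d = Comp X (Comp X (res_arr X x W) (res_incl X x (U \<inter> V) W)) m"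
        using d(2) i(2) by simp
      also have "\<dots> = Comp X (res_arr X x W) (Comp X (res_incl X x (U \<inter> V) W) m)"
        using i(1) rx(1)[of W] m(1) by (simp add: arrow_defs Comp_simps)
      finally have e: "Comp X (res_arr X x W) d =
        Comp X (res_arr X x W) (Comp X (res_incl X x (U \<inter> V) W) m)" .
      have "d = Comp X (res_incl X x (U \<inter> V) W) m"
        by (rule ihom_cancel[where z = x, OF d(1) ihom_Comp[OF m(1) i(1)] _ e])
           (use rx(1)[of W] in \<open>simp add: ihom_def\<close>)
      then have "Comp X (?\<psi> W) d =
        Comp X (Comp X (res_arr X y W) (Comp X (\<phi> W) (res_incl X x (U \<inter> V) W))) m"
        using ry(1)[of W] p[OF W(1)] i(1) m(1) by (simp add: arrow_defs Comp_simps)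
      also have "\<dots> = Comp X (res_arr X y (U \<inter> V)) (Comp X (res_iso X x y (U \<inter> V) W (\<phi> W)) m)"
        unfolding r2[symmetric]
        using ry(1)[of "U \<inter> V"] r1 m(1) by (simp add: arrow_defs Comp_simps)
      finally show ?thesis .
    qed
    from this[of U a] this[of V b] show ?thesis using UV ab m e pc[OF UV] by auto
  qed
  have "\<exists>!k. k \<in> vhom X x y \<and> (\<forall>U\<in>\<U>. Comp X k (res_arr X x U) = ?\<psi> U)"
  proof (rule glue[unfolded glues_arrows_def, rule_format, OF cover xy])
    show "pObj X (res X x U) = subtopology T U \<and> res_arr X x U \<in> ihom X (res X x U) x \<and>
      ?\<psi> U \<in> ihom X (res X x U) y" if "U \<in> \<U>" for U
      using rx p[OF that] ihom_Comp[OF _ ry(1)] by (auto simp: vhom_iff_ihom)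
  qed (rule compat)
  moreover have "base_change X (res_arr X x U) (res_arr X y U) k = \<phi> U \<longleftrightarrow>
     Comp X k (res_arr X x U) = ?\<psi> U" if "U \<in> \<U>" "k \<in> vhom X x y" for U k
    using base_change_eq_iff[of "res_arr X x U" "res X x U" x "res_arr X y U" "res X y U" y k "\<phi> U"]
      rx[of U] ry[of U] p[of U] that by (auto simp: ihom_def)
  ultimately show ?thesis by (simp add: viso_eq_vhom cong: conj_cong)
qed

end

lemma ihom_hom: "k \<in> ihom X x y \<Longrightarrow> k \<in> hom X x y"
  by (simp add: ihom_def)

lemma vhom_ihom: "k \<in> vhom X x y \<Longrightarrow> k \<in> ihom X x y"
  by (simp add: vhom_iff_ihom)

section \<open>Descent data expressed by test objects and spans\<close>

context fibred_in_groupoids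
begin

text \<open>Nesting to the right hides the pair of arrows that an equation rewrites; this rule and
  the next reach it.\<close>

lemma Comp_rewrite:
  assumes "Comp X h g = k" "g \<in> hom X x y" "h \<in> hom X y z" "f \<in> hom X w x"
  shows "Comp X h (Comp X g f) = Comp X k f"
  using Comp_assoc[OF assms(4,2,3)] assms(1) by simp

lemma Comp_square:
  assumes "Comp X h g = Comp X h' g'" "g \<in> hom X x y" "h \<in> hom X y z"
    "g' \<in> hom X x y'" "h' \<in> hom X y' z'" "f \<in> hom X w x"
  shows "Comp X h (Comp X g f) = Comp X h' (Comp X g' f)"
  using Comp_assoc[OF assms(6,2,3)] Comp_assoc[OF assms(6,4,5)] assms(1) by simp

lemma ihom_lift_vhom:
  assumes "k \<in> ihom X x z" "l \<in> ihom X y z" "pObj X x = pObj X y"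
  shows "\<exists>h\<in>vhom X x y. Comp X l h = k"
  using vhom_lift[of k x z l y] assms by (auto simp: ihom_def)

lemma pObj_res:
  assumes "x \<in> Obj X" "pObj X x = subtopology T U" "V \<subseteq> U"
  shows "pObj X (res X x V) = subtopology T V"
  using assms by (simp add: res_arr_spec subtopology_subtopology Int_absorb1)

text \<open>Both sides express one equation of arrows into \<open>z\<close>. A test triple
  \<open>f\<close>, \<open>g\<close>, \<open>h\<close> always comes from the canonical triple on
  \<open>res X x N\<close>, so the cocycle condition there is as strong as the condition on all test
  objects.\<close>

lemma cocycle_iff:
  fixes U V W :: "'a set"
  defines "N \<equiv> U \<inter> V \<inter> W"
  assumes x: "x \<in> Obj X" "pObj X x = subtopology T U"
    and y: "y \<in> Obj X" "pObj X y = subtopology T V"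
    and z: "z \<in> Obj X" "pObj X z = subtopology T W"
    and p: "p \<in> vhom X (res X x (U \<inter> V)) (res X y (U \<inter> V))"
    and q: "q \<in> vhom X (res X y (V \<inter> W)) (res X z (V \<inter> W))"
    and r: "r \<in> vhom X (res X x (U \<inter> W)) (res X z (U \<inter> W))"
  shows "Comp X (res_iso X y z N (V \<inter> W) q) (res_iso X x y N (U \<inter> V) p)
      = res_iso X x z N (U \<inter> W) r \<longleftrightarrow>
    (\<forall>t f g h. pObj X t = subtopology T N \<longrightarrow> f \<in> ihom X t (res X x (U \<inter> V)) \<longrightarrow>
      g \<in> ihom X t (res X y (V \<inter> W)) \<longrightarrow> h \<in> ihom X t (res X x (U \<inter> W)) \<longrightarrow>
      Comp X (res_arr X x (U \<inter> V)) f = Comp X (res_arr X x (U \<inter> W)) h \<longrightarrow>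
      Comp X (Comp X (res_arr X y (U \<inter> V)) p) f = Comp X (res_arr X y (V \<inter> W)) g \<longrightarrow>
      Comp X (Comp X (res_arr X z (V \<inter> W)) q) g = Comp X (Comp X (res_arr X z (U \<inter> W)) r) h)"
    (is "?L \<longleftrightarrow> ?R")
proof -
  have N: "N \<subseteq> U" "N \<subseteq> V" "N \<subseteq> W" "N \<subseteq> U \<inter> V" "N \<subseteq> V \<inter> W" "N \<subseteq> U \<inter> W"
    by (auto simp: N_def)
  note pN = pObj_res[OF x N(1)] pObj_res[OF y N(2)] pObj_res[OF z N(3)]
  have ra: "res_arr X x V' \<in> hom X (res X x V') x" "res_arr X y V' \<in> hom X (res X y V') y"
    "res_arr X z V' \<in> hom X (res X z V') z" for V'
    using res_arr_spec(1) x y z by (auto intro: ihom_hom)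
  note i1 = res_incl_spec[OF x(1) N(4)] and i2 = res_incl_spec[OF x(1) N(6)]
    and i3 = res_incl_spec[OF y(1) N(5)]
  note i1h = i1(1)[THEN ihom_hom] and i2h = i2(1)[THEN ihom_hom] and i3h = i3(1)[THEN ihom_hom]
  note l0 = res_iso_spec[OF x(1) y(1) _ N(4) p, unfolded pN, OF refl]
  note l1 = res_iso_spec[OF y(1) z(1) _ N(5) q, unfolded pN, OF refl]
  note l2 = res_iso_spec[OF x(1) z(1) _ N(6) r, unfolded pN, OF refl]
  let ?l0 = "res_iso X x y N (U \<inter> V) p" and ?l1 = "res_iso X y z N (V \<inter> W) q"
    and ?l2 = "res_iso X x z N (U \<inter> W) r"
  let ?i1 = "res_incl X x N (U \<inter> V)" and ?i2 = "res_incl X x N (U \<inter> W)"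
    and ?i3 = "res_incl X y N (V \<inter> W)"
  note l0h = l0(1)[THEN vhom_hom] and l1h = l1(1)[THEN vhom_hom] and l2h = l2(1)[THEN vhom_hom]
  note ph = p[THEN vhom_hom] and qh = q[THEN vhom_hom] and rh = r[THEN vhom_hom]
  \<comment> \<open>The gluing isomorphisms are absorbed into arrows that end in \<open>y\<close>
    and \<open>z\<close>, which removes the chosen restrictions at their targets.\<close>
  define B where "B = Comp X (res_arr X y (U \<inter> V)) p"
  define C where "C = Comp X (res_arr X z (V \<inter> W)) q"
  define D where "D = Comp X (res_arr X z (U \<inter> W)) r"
  have B: "B \<in> hom X (res X x (U \<inter> V)) y" "Comp X (res_arr X y N) ?l0 = Comp X B ?i1"
    unfolding B_def l0(2) using Comp_in[OF ph ra(2)] Comp_assoc[OF i1h ph ra(2)] by simp_all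
  have C: "C \<in> hom X (res X y (V \<inter> W)) z" "Comp X (res_arr X z N) ?l1 = Comp X C ?i3"
    unfolding C_def l1(2) using Comp_in[OF qh ra(3)] Comp_assoc[OF i3h qh ra(3)] by simp_all
  have D: "D \<in> hom X (res X x (U \<inter> W)) z" "Comp X (res_arr X z N) ?l2 = Comp X D ?i2"
    unfolding D_def l2(2) using Comp_in[OF rh ra(3)] Comp_assoc[OF i2h rh ra(3)] by simp_all
  note g0 = Comp_in[OF l0h i3h]
  have "?L \<longleftrightarrow> Comp X (res_arr X z N) (Comp X ?l1 ?l0) = Comp X (res_arr X z N) ?l2"
    using ihom_cancel[OF _ _ ra(3)[of N]] Comp_vhom[OF l0(1) l1(1)] l2(1)
    by (auto simp: vhom_iff_ihom)
  also have "\<dots> \<longleftrightarrow> Comp X C (Comp X ?i3 ?l0) = Comp X D ?i2"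
    by (simp add: D Comp_square[OF C(2) l1h ra(3) i3h C(1) l0h])
  also have "\<dots> \<longleftrightarrow> ?R"
    unfolding B_def[symmetric] C_def[symmetric] D_def[symmetric]
  proof (intro iffI allI impI)
    fix t f g h
    assume key: "Comp X C (Comp X ?i3 ?l0) = Comp X D ?i2" and t: "pObj X t = subtopology T N"
      and f: "f \<in> ihom X t (res X x (U \<inter> V))"
      and g: "g \<in> ihom X t (res X y (V \<inter> W))" and h: "h \<in> ihom X t (res X x (U \<inter> W))"
      and fh: "Comp X (res_arr X x (U \<inter> V)) f = Comp X (res_arr X x (U \<inter> W)) h"
      and fg: "Comp X B f = Comp X (res_arr X y (V \<inter> W)) g"
    \<comment> \<open>\<open>f\<close> and \<open>h\<close> have the same composite into
      \<open>x\<close>, so both factor through one \<open>m\<close>. Then \<open>g\<close> is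
      forced, because an inclusion arrow into a restriction of \<open>y\<close> is determined by its
      composite into \<open>y\<close>.\<close>
    obtain m where m: "m \<in> ihom X t (res X x N)"
      "Comp X (res_arr X x N) m = Comp X (res_arr X x (U \<inter> V)) f"
      using ihom_lift_vhom[OF ihom_Comp[OF f res_arr_spec(1)[OF x(1)]] res_arr_spec(1)[OF x(1)], of N]
      by (auto simp: t pN dest: vhom_ihom)
    note mh = m(1)[THEN ihom_hom]
    have f': "f = Comp X ?i1 m"
      by (rule ihom_cancel[OF f ihom_Comp[OF m(1) i1(1)] ra(1)])
         (simp add: Comp_rewrite[OF i1(2) i1h ra(1) mh] m(2))
    have h': "h = Comp X ?i2 m"
      by (rule ihom_cancel[OF h ihom_Comp[OF m(1) i2(1)] ra(1)])
         (simp add: Comp_rewrite[OF i2(2) i2h ra(1) mh] m(2) fh)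
    have g': "g = Comp X (Comp X ?i3 ?l0) m"
    proof (rule ihom_cancel[OF g ihom_Comp[OF m(1) ihom_Comp[OF vhom_ihom[OF l0(1)] i3(1)]] ra(2)])
      have "Comp X (res_arr X y (V \<inter> W)) (Comp X (Comp X ?i3 ?l0) m) =
        Comp X (res_arr X y N) (Comp X ?l0 m)"
        using Comp_assoc[OF mh l0h i3h] Comp_rewrite[OF i3(2) i3h ra(2) Comp_in[OF mh l0h]] by simp
      also have "\<dots> = Comp X B f"
        unfolding f' by (rule Comp_square[OF B(2) l0h ra(2) i1h B(1) mh])
      finally show "Comp X (res_arr X y (V \<inter> W)) g =
        Comp X (res_arr X y (V \<inter> W)) (Comp X (Comp X ?i3 ?l0) m)" by (simp add: fg)
    qed
    show "Comp X C g = Comp X D h"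
      unfolding g' h' by (rule Comp_square[OF key g0 C(1) i2h D(1) mh])
  next
    assume R: "\<forall>t f g h. pObj X t = subtopology T N \<longrightarrow> f \<in> ihom X t (res X x (U \<inter> V)) \<longrightarrow>
      g \<in> ihom X t (res X y (V \<inter> W)) \<longrightarrow> h \<in> ihom X t (res X x (U \<inter> W)) \<longrightarrow>
      Comp X (res_arr X x (U \<inter> V)) f = Comp X (res_arr X x (U \<inter> W)) h \<longrightarrow>
      Comp X B f = Comp X (res_arr X y (V \<inter> W)) g \<longrightarrow> Comp X C g = Comp X D h"
    \<comment> \<open>The required equation is the test at the universal object
      \<open>res X x N\<close> itself.\<close>
    show "Comp X C (Comp X ?i3 ?l0) = Comp X D ?i2"
    proof (rule R[rule_format, OF pN(1) i1(1) ihom_Comp[OF vhom_ihom[OF l0(1)] i3(1)] i2(1)])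
      show "Comp X (res_arr X x (U \<inter> V)) ?i1 = Comp X (res_arr X x (U \<inter> W)) ?i2"
        using i1 i2 by simp
      show "Comp X B ?i1 = Comp X (res_arr X y (V \<inter> W)) (Comp X ?i3 ?l0)"
        using B(2) Comp_rewrite[OF i3(2) i3h ra(2) l0h] by simp
    qed
  qed
  finally show ?thesis .
qed

end

text \<open>A descent datum presented by spans \<open>x U \<leftarrow> w U V \<rightarrow> x V\<close> over \<open>U \<inter> V\<close>, which need not be
  the chosen restrictions.\<close>

definition gluing_datum ::
  "('o, 'm, 'a) category_over \<Rightarrow> 'a topology \<Rightarrow> 'a set set \<Rightarrow> ('a set \<Rightarrow> 'o) \<Rightarrow>
    ('a set \<Rightarrow> 'a set \<Rightarrow> 'o) \<Rightarrow> ('a set \<Rightarrow> 'a set \<Rightarrow> 'm) \<Rightarrow> ('a set \<Rightarrow> 'a set \<Rightarrow> 'm) \<Rightarrow> bool" where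
  "gluing_datum X T \<U> x w a b \<longleftrightarrow>
     (\<forall>U\<in>\<U>. x U \<in> Obj X \<and> pObj X (x U) = subtopology T U) \<and>
     (\<forall>U\<in>\<U>. \<forall>V\<in>\<U>. pObj X (w U V) = subtopology T (U \<inter> V) \<and>
        a U V \<in> ihom X (w U V) (x U) \<and> b U V \<in> ihom X (w U V) (x V)) \<and>
     (\<forall>U\<in>\<U>. \<forall>V\<in>\<U>. \<forall>W\<in>\<U>. \<forall>t f g h. pObj X t = subtopology T (U \<inter> V \<inter> W) \<longrightarrow>
        f \<in> ihom X t (w U V) \<longrightarrow> g \<in> ihom X t (w V W) \<longrightarrow> h \<in> ihom X t (w U W) \<longrightarrow>
        Comp X (a U V) f = Comp X (a U W) h \<longrightarrow> Comp X (b U V) f = Comp X (a V W) g \<longrightarrow>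
        Comp X (b V W) g = Comp X (b U W) h)"

text \<open>The comparison runs from the piece into the glued object, the reverse of
  \<open>\<alpha>\<close> in \<open>effective\<close>; the overlap condition is then a plain
  equation of arrows into \<open>z\<close>.\<close>

definition gluing_effective ::
  "('o, 'm, 'a) category_over \<Rightarrow> 'a topology \<Rightarrow> 'a set set \<Rightarrow> ('a set \<Rightarrow> 'o) \<Rightarrow>
    ('a set \<Rightarrow> 'a set \<Rightarrow> 'm) \<Rightarrow> ('a set \<Rightarrow> 'a set \<Rightarrow> 'm) \<Rightarrow> bool" where
  "gluing_effective X T \<U> x a b \<longleftrightarrow>
     (\<exists>z \<zeta>. z \<in> Obj X \<and> pObj X z = T \<and> (\<forall>U\<in>\<U>. \<zeta> U \<in> ihom X (x U) z) \<and>
        (\<forall>U\<in>\<U>. \<forall>V\<in>\<U>. Comp X (\<zeta> U) (a U V) = Comp X (\<zeta> V) (b U V)))"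

context fibred_in_groupoids
begin

text \<open>The apex of the span is the chosen restriction of \<open>x U\<close>, and the gluing
  isomorphism is absorbed into the right leg. The content lies in the cocycle condition, which is
  \<open>cocycle_iff\<close>.\<close>

lemma descent_datum_iff:
  assumes x: "\<And>U. U \<in> \<U> \<Longrightarrow> x U \<in> Obj X" "\<And>U. U \<in> \<U> \<Longrightarrow> pObj X (x U) = subtopology T U"
    and p: "\<And>U V. U \<in> \<U> \<Longrightarrow> V \<in> \<U> \<Longrightarrow>
      \<phi> U V \<in> vhom X (res X (x U) (U \<inter> V)) (res X (x V) (U \<inter> V))"
  shows "descent_datum X T \<U> x \<phi> \<longleftrightarrow>
    gluing_datum X T \<U> x (\<lambda>U V. res X (x U) (U \<inter> V)) (\<lambda>U V. res_arr X (x U) (U \<inter> V))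
      (\<lambda>U V. Comp X (res_arr X (x V) (U \<inter> V)) (\<phi> U V))"
proof -
  have 1: "pObj X (res X (x U) (U \<inter> V)) = subtopology T (U \<inter> V)"
    "res_arr X (x U) (U \<inter> V) \<in> ihom X (res X (x U) (U \<inter> V)) (x U)"
    "Comp X (res_arr X (x V) (U \<inter> V)) (\<phi> U V) \<in> ihom X (res X (x U) (U \<inter> V)) (x V)"
    if "U \<in> \<U>" "V \<in> \<U>" for U V
    using that x p pObj_res res_arr_spec(1) ihom_Comp[OF vhom_ihom[OF p] res_arr_spec(1)] by auto
  have 2: "Comp X (res_iso X (x V) (x W) (U \<inter> V \<inter> W) (V \<inter> W) (\<phi> V W))
               (res_iso X (x U) (x V) (U \<inter> V \<inter> W) (U \<inter> V) (\<phi> U V))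
        = res_iso X (x U) (x W) (U \<inter> V \<inter> W) (U \<inter> W) (\<phi> U W) \<longleftrightarrow>
     (\<forall>t f g h. pObj X t = subtopology T (U \<inter> V \<inter> W) \<longrightarrow>
        f \<in> ihom X t (res X (x U) (U \<inter> V)) \<longrightarrow> g \<in> ihom X t (res X (x V) (V \<inter> W)) \<longrightarrow>
        h \<in> ihom X t (res X (x U) (U \<inter> W)) \<longrightarrow>
        Comp X (res_arr X (x U) (U \<inter> V)) f = Comp X (res_arr X (x U) (U \<inter> W)) h \<longrightarrow>
        Comp X (Comp X (res_arr X (x V) (U \<inter> V)) (\<phi> U V)) f = Comp X (res_arr X (x V) (V \<inter> W)) g \<longrightarrow>
        Comp X (Comp X (res_arr X (x W) (V \<inter> W)) (\<phi> V W)) g =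
          Comp X (Comp X (res_arr X (x W) (U \<inter> W)) (\<phi> U W)) h)"
    if "U \<in> \<U>" "V \<in> \<U>" "W \<in> \<U>" for U V W
    by (rule cocycle_iff) (use that x p in auto)
  show ?thesis
    unfolding descent_datum_def gluing_datum_def viso_eq_vhom
    by (simp add: 1 2 x p cong: ball_cong)
qed

text \<open>The comparisons \<open>\<zeta> U\<close> and \<open>\<alpha> U\<close> determine each
  other by \<open>Comp X (\<zeta> U) (\<alpha> U) = res_arr X z U\<close>: in one direction
  \<open>\<alpha> U\<close> is inverted, in the other the restriction arrow is lifted through
  \<open>\<zeta> U\<close>.\<close>

lemma effective_iff:
  assumes sub: "\<And>U. U \<in> \<U> \<Longrightarrow> U \<subseteq> topspace T"
    and x: "\<And>U. U \<in> \<U> \<Longrightarrow> x U \<in> Obj X" "\<And>U. U \<in> \<U> \<Longrightarrow> pObj X (x U) = subtopology T U"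
    and p: "\<And>U V. U \<in> \<U> \<Longrightarrow> V \<in> \<U> \<Longrightarrow>
      \<phi> U V \<in> vhom X (res X (x U) (U \<inter> V)) (res X (x V) (U \<inter> V))"
  shows "effective X T \<U> x \<phi> \<longleftrightarrow>
    gluing_effective X T \<U> x (\<lambda>U V. res_arr X (x U) (U \<inter> V))
      (\<lambda>U V. Comp X (res_arr X (x V) (U \<inter> V)) (\<phi> U V))" (is "?L \<longleftrightarrow> ?R")
proof -
  have bc: "base_change X (res_incl X z (U \<inter> V) W) (res_arr X (x W) (U \<inter> V)) k
      \<in> vhom X (res X z (U \<inter> V)) (res X (x W) (U \<inter> V))"
    "Comp X (res_arr X (x W) (U \<inter> V))
        (base_change X (res_incl X z (U \<inter> V) W) (res_arr X (x W) (U \<inter> V)) k) =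
      Comp X k (res_incl X z (U \<inter> V) W)"
    if z: "z \<in> Obj X" "pObj X z = T" and W: "W \<in> \<U>" "U \<inter> V \<subseteq> W"
      and k: "k \<in> vhom X (res X z W) (x W)" for z U V W k
  proof -
    have o: "pObj X (res X z (U \<inter> V)) = subtopology T (U \<inter> V)"
      "pObj X (res X (x W) (U \<inter> V)) = subtopology T (U \<inter> V)"
      using z W res_arr_spec(2)[OF z(1)] pObj_res[OF x] by auto
    have i: "res_incl X z (U \<inter> V) W \<in> ihom X (res X z (U \<inter> V)) (res X z W)"
      "res_arr X (x W) (U \<inter> V) \<in> ihom X (res X (x W) (U \<inter> V)) (x W)"
      using z W res_incl_spec(1) res_arr_spec(1) x by auto
    note * = base_change_spec[OF i[THEN ihom_hom] k]
    show "base_change X (res_incl X z (U \<inter> V) W) (res_arr X (x W) (U \<inter> V)) k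
      \<in> vhom X (res X z (U \<inter> V)) (res X (x W) (U \<inter> V))"
      by (rule *) (use i o in \<open>auto simp: ihom_def\<close>)
    show "Comp X (res_arr X (x W) (U \<inter> V))
        (base_change X (res_incl X z (U \<inter> V) W) (res_arr X (x W) (U \<inter> V)) k) =
      Comp X k (res_incl X z (U \<inter> V) W)"
      by (rule *) (use i o in \<open>auto simp: ihom_def\<close>)
  qed
  show ?thesis
  proof
    assume ?L
    then obtain z \<alpha> where z: "z \<in> Obj X" "pObj X z = T"
      and \<alpha>: "\<And>U. U \<in> \<U> \<Longrightarrow> \<alpha> U \<in> vhom X (res X z U) (x U)"
      and e: "\<And>U V. U \<in> \<U> \<Longrightarrow> V \<in> \<U> \<Longrightarrow>
         Comp X (\<phi> U V)
             (base_change X (res_incl X z (U \<inter> V) U) (res_arr X (x U) (U \<inter> V)) (\<alpha> U))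
           = base_change X (res_incl X z (U \<inter> V) V) (res_arr X (x V) (U \<inter> V)) (\<alpha> V)"
      unfolding effective_def viso_eq_vhom by blast
    have "\<exists>\<zeta>\<in>ihom X (x U) z. Comp X \<zeta> (\<alpha> U) = res_arr X z U" if U: "U \<in> \<U>" for U
    proof -
      obtain l where l: "l \<in> vhom X (x U) (res X z U)" "Comp X l (\<alpha> U) = Id X (res X z U)"
        using vhom_inverse[OF \<alpha>[OF U]] by metis
      note r = res_arr_spec(1)[OF z(1), of U]
      have "Comp X (Comp X (res_arr X z U) l) (\<alpha> U) = Comp X (res_arr X z U) (Id X (res X z U))"
        using Comp_assoc[OF vhom_hom[OF \<alpha>[OF U]] vhom_hom[OF l(1)] ihom_hom[OF r]] l(2) by simp
      then show ?thesis
        using ihom_Comp[OF vhom_ihom[OF l(1)] r] Comp_Id_right[OF ihom_hom[OF r]] by auto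
    qed
    then obtain \<zeta> where \<zeta>: "\<And>U. U \<in> \<U> \<Longrightarrow> \<zeta> U \<in> ihom X (x U) z"
      "\<And>U. U \<in> \<U> \<Longrightarrow> Comp X (\<zeta> U) (\<alpha> U) = res_arr X z U" by metis
    have "Comp X (\<zeta> U) (res_arr X (x U) (U \<inter> V)) =
        Comp X (\<zeta> V) (Comp X (res_arr X (x V) (U \<inter> V)) (\<phi> U V))"
      if UV: "U \<in> \<U>" "V \<in> \<U>" for U V
    proof -
      let ?c = "\<lambda>W. base_change X (res_incl X z (U \<inter> V) W) (res_arr X (x W) (U \<inter> V)) (\<alpha> W)"
      \<comment> \<open>Both pieces are compared on \<open>res X z (U \<inter> V)\<close>, where
        each composite into \<open>z\<close> is the same restriction arrow.\<close>
      have W: "?c W \<in> vhom X (res X z (U \<inter> V)) (res X (x W) (U \<inter> V))"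
        "Comp X (\<zeta> W) (Comp X (res_arr X (x W) (U \<inter> V)) (?c W)) = res_arr X z (U \<inter> V)"
        if W: "W \<in> \<U>" "U \<inter> V \<subseteq> W" for W
      proof -
        note c = bc[OF z W \<alpha>[OF W(1)]] and i = res_incl_spec[OF z(1) W(2)]
        show "?c W \<in> vhom X (res X z (U \<inter> V)) (res X (x W) (U \<inter> V))" by (rule c)
        show "Comp X (\<zeta> W) (Comp X (res_arr X (x W) (U \<inter> V)) (?c W)) = res_arr X z (U \<inter> V)"
          unfolding c(2) i(2)[symmetric]
          by (rule Comp_rewrite[OF \<zeta>(2)[OF W(1)] vhom_hom[OF \<alpha>[OF W(1)]] ihom_hom[OF \<zeta>(1)[OF W(1)]]
                ihom_hom[OF i(1)]])
      qed
      have ra: "res_arr X (x W) (U \<inter> V) \<in> hom X (res X (x W) (U \<inter> V)) (x W)" if "W \<in> \<U>" for W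
        using res_arr_spec(1)[OF x(1)[OF that]] by (rule ihom_hom)
      note cU = W[OF UV(1) Int_lower1] and cV = W[OF UV(2) Int_lower2]
      note \<zeta>h = ihom_hom[OF \<zeta>(1)] and ph = vhom_hom[OF p[OF UV]]
      show ?thesis
      proof (rule vhom_cancel_right[OF cU(1)])
        show "Comp X (\<zeta> U) (res_arr X (x U) (U \<inter> V)) \<in> hom X (res X (x U) (U \<inter> V)) z"
          by (rule Comp_in[OF ra[OF UV(1)] \<zeta>h[OF UV(1)]])
        show "Comp X (\<zeta> V) (Comp X (res_arr X (x V) (U \<inter> V)) (\<phi> U V)) \<in> hom X (res X (x U) (U \<inter> V)) z"
          by (rule Comp_in[OF Comp_in[OF ph ra[OF UV(2)]] \<zeta>h[OF UV(2)]])
        have "Comp X (Comp X (\<zeta> U) (res_arr X (x U) (U \<inter> V))) (?c U) = res_arr X z (U \<inter> V)"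
          using Comp_assoc[OF vhom_hom[OF cU(1)] ra[OF UV(1)] \<zeta>h[OF UV(1)]] cU(2) by simp
        moreover have "Comp X (Comp X (\<zeta> V) (Comp X (res_arr X (x V) (U \<inter> V)) (\<phi> U V))) (?c U)
          = res_arr X z (U \<inter> V)"
          using cV(2) Comp_assoc[OF vhom_hom[OF cU(1)] ph ra[OF UV(2)]] e[OF UV]
            Comp_assoc[OF vhom_hom[OF cU(1)] Comp_in[OF ph ra[OF UV(2)]] \<zeta>h[OF UV(2)]] by simp
        ultimately show "Comp X (Comp X (\<zeta> U) (res_arr X (x U) (U \<inter> V))) (?c U) =
          Comp X (Comp X (\<zeta> V) (Comp X (res_arr X (x V) (U \<inter> V)) (\<phi> U V))) (?c U)" by simp
      qed
    qed
    then show ?R unfolding gluing_effective_def using z \<zeta>(1) by blast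
  next
    assume ?R
    then obtain z \<zeta> where z: "z \<in> Obj X" "pObj X z = T"
      and \<zeta>: "\<And>U. U \<in> \<U> \<Longrightarrow> \<zeta> U \<in> ihom X (x U) z"
      and e: "\<And>U V. U \<in> \<U> \<Longrightarrow> V \<in> \<U> \<Longrightarrow> Comp X (\<zeta> U) (res_arr X (x U) (U \<inter> V)) =
        Comp X (\<zeta> V) (Comp X (res_arr X (x V) (U \<inter> V)) (\<phi> U V))"
      unfolding gluing_effective_def by blast
    have "\<exists>\<alpha>\<in>vhom X (res X z U) (x U). Comp X (\<zeta> U) \<alpha> = res_arr X z U" if U: "U \<in> \<U>" for U
      using ihom_lift_vhom[OF res_arr_spec(1)[OF z(1)] \<zeta>[OF U]] res_arr_spec(2)[OF z(1)] x(2)[OF U]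
      by (simp add: z(2))
    then obtain \<alpha> where \<alpha>: "\<And>U. U \<in> \<U> \<Longrightarrow> \<alpha> U \<in> vhom X (res X z U) (x U)"
      "\<And>U. U \<in> \<U> \<Longrightarrow> Comp X (\<zeta> U) (\<alpha> U) = res_arr X z U" by metis
    have "Comp X (\<phi> U V)
             (base_change X (res_incl X z (U \<inter> V) U) (res_arr X (x U) (U \<inter> V)) (\<alpha> U))
           = base_change X (res_incl X z (U \<inter> V) V) (res_arr X (x V) (U \<inter> V)) (\<alpha> V)"
      if UV: "U \<in> \<U>" "V \<in> \<U>" for U V
    proof -
      let ?c = "\<lambda>W. base_change X (res_incl X z (U \<inter> V) W) (res_arr X (x W) (U \<inter> V)) (\<alpha> W)"
      have W: "?c W \<in> vhom X (res X z (U \<inter> V)) (res X (x W) (U \<inter> V))"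
        "Comp X (\<zeta> W) (Comp X (res_arr X (x W) (U \<inter> V)) (?c W)) = res_arr X z (U \<inter> V)"
        if W: "W \<in> \<U>" "U \<inter> V \<subseteq> W" for W
      proof -
        note c = bc[OF z W \<alpha>(1)[OF W(1)]] and i = res_incl_spec[OF z(1) W(2)]
        show "?c W \<in> vhom X (res X z (U \<inter> V)) (res X (x W) (U \<inter> V))" by (rule c)
        show "Comp X (\<zeta> W) (Comp X (res_arr X (x W) (U \<inter> V)) (?c W)) = res_arr X z (U \<inter> V)"
          unfolding c(2) i(2)[symmetric]
          by (rule Comp_rewrite[OF \<alpha>(2)[OF W(1)] vhom_hom[OF \<alpha>(1)[OF W(1)]] ihom_hom[OF \<zeta>(1)[OF W(1)]]
                ihom_hom[OF i(1)]])
      qed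
      have ra: "res_arr X (x W) (U \<inter> V) \<in> hom X (res X (x W) (U \<inter> V)) (x W)" if "W \<in> \<U>" for W
        using res_arr_spec(1)[OF x(1)[OF that]] by (rule ihom_hom)
      note cU = W[OF UV(1) Int_lower1] and cV = W[OF UV(2) Int_lower2]
      note \<zeta>h = ihom_hom[OF \<zeta>] and ph = vhom_hom[OF p[OF UV]]
      have l: "Comp X (\<zeta> V) (res_arr X (x V) (U \<inter> V)) \<in> hom X (res X (x V) (U \<inter> V)) z"
        by (rule Comp_in[OF ra[OF UV(2)] \<zeta>h[OF UV(2)]])
      have "Comp X (Comp X (\<zeta> V) (res_arr X (x V) (U \<inter> V))) (Comp X (\<phi> U V) (?c U)) =
        Comp X (Comp X (\<zeta> V) (Comp X (res_arr X (x V) (U \<inter> V)) (\<phi> U V))) (?c U)"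
        using Comp_assoc[OF vhom_hom[OF cU(1)] ph l] Comp_assoc[OF ph ra[OF UV(2)] \<zeta>h[OF UV(2)]]
        by simp
      also have "\<dots> = res_arr X z (U \<inter> V)"
        unfolding e[OF UV, symmetric]
        using Comp_assoc[OF vhom_hom[OF cU(1)] ra[OF UV(1)] \<zeta>h[OF UV(1)]] cU(2) by simp
      also have "\<dots> = Comp X (Comp X (\<zeta> V) (res_arr X (x V) (U \<inter> V))) (?c V)"
        using Comp_assoc[OF vhom_hom[OF cV(1)] ra[OF UV(2)] \<zeta>h[OF UV(2)]] cV(2) by simp
      finally show ?thesis
        by (rule ihom_cancel[OF vhom_ihom[OF Comp_vhom[OF cU(1) p[OF UV]]] vhom_ihom[OF cV(1)] l])
    qed
    then show ?L unfolding effective_def viso_eq_vhom using z \<alpha>(1) by blast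
  qed
qed

end

text \<open>The apex \<open>w U V\<close> and the chosen restriction of \<open>x U\<close> are both
  restrictions of \<open>x U\<close> to the overlap, hence isomorphic by some \<open>m U V\<close>.
  Transport along \<open>m\<close> gives a descent datum in the sense of the axiom; cancelling
  \<open>m\<close> returns to the original spans.\<close>

lemma (in stack) gluing_effective:
  assumes cover: "open_cover T \<U>" and d: "gluing_datum X T \<U> x w a b"
  shows "gluing_effective X T \<U> x a b"
proof -
  have x: "\<And>U. U \<in> \<U> \<Longrightarrow> x U \<in> Obj X" "\<And>U. U \<in> \<U> \<Longrightarrow> pObj X (x U) = subtopology T U"
    and w: "\<And>U V. U \<in> \<U> \<Longrightarrow> V \<in> \<U> \<Longrightarrow> pObj X (w U V) = subtopology T (U \<inter> V)"
    and a: "\<And>U V. U \<in> \<U> \<Longrightarrow> V \<in> \<U> \<Longrightarrow> a U V \<in> ihom X (w U V) (x U)"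
    and b: "\<And>U V. U \<in> \<U> \<Longrightarrow> V \<in> \<U> \<Longrightarrow> b U V \<in> ihom X (w U V) (x V)"
    and coc: "\<And>U V W t f g h. U \<in> \<U> \<Longrightarrow> V \<in> \<U> \<Longrightarrow> W \<in> \<U> \<Longrightarrow>
        pObj X t = subtopology T (U \<inter> V \<inter> W) \<Longrightarrow>
        f \<in> ihom X t (w U V) \<Longrightarrow> g \<in> ihom X t (w V W) \<Longrightarrow> h \<in> ihom X t (w U W) \<Longrightarrow>
        Comp X (a U V) f = Comp X (a U W) h \<Longrightarrow> Comp X (b U V) f = Comp X (a V W) g \<Longrightarrow>
        Comp X (b V W) g = Comp X (b U W) h"
    using d unfolding gluing_datum_def by blast+
  let ?r = "\<lambda>U V. res X (x U) (U \<inter> V)" and ?a = "\<lambda>U V. res_arr X (x U) (U \<inter> V)"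
  have ra: "?a U V \<in> ihom X (?r U V) (x U)" if "U \<in> \<U>" for U V
    by (rule res_arr_spec(1)[OF x(1)[OF that]])
  have po: "pObj X (res X (x W) (U \<inter> V)) = subtopology T (U \<inter> V)" if "W \<in> \<U>" "U \<inter> V \<subseteq> W" for W U V
    by (rule pObj_res[OF x[OF that(1)] that(2)])
  have "\<exists>m\<in>vhom X (?r U V) (w U V). Comp X (a U V) m = ?a U V" if UV: "U \<in> \<U>" "V \<in> \<U>" for U V
    using ihom_lift_vhom[OF ra[OF UV(1)] a[OF UV]] po[OF UV(1), of U V] w[OF UV] by simp
  then obtain m where m: "\<And>U V. U \<in> \<U> \<Longrightarrow> V \<in> \<U> \<Longrightarrow> m U V \<in> vhom X (?r U V) (w U V)"
    "\<And>U V. U \<in> \<U> \<Longrightarrow> V \<in> \<U> \<Longrightarrow> Comp X (a U V) (m U V) = ?a U V" by metis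
  \<comment> \<open>The gluing isomorphism is the transported right leg, factored through the chosen
    restriction of \<open>x V\<close>.\<close>
  have "\<exists>p\<in>vhom X (?r U V) (res X (x V) (U \<inter> V)).
      Comp X (res_arr X (x V) (U \<inter> V)) p = Comp X (b U V) (m U V)" if UV: "U \<in> \<U>" "V \<in> \<U>" for U V
  proof -
    have bm: "Comp X (b U V) (m U V) \<in> ihom X (?r U V) (x V)"
      by (rule ihom_Comp[OF vhom_ihom[OF m(1)[OF UV]] b[OF UV]])
    note r = res_arr_spec(1)[OF x(1)[OF UV(2)], of "U \<inter> V"]
    show ?thesis
      using ihom_lift_vhom[OF bm r] po[OF UV(1), of U V] po[OF UV(2), of U V] by simp
  qed
  then obtain \<phi> where \<phi>: "\<And>U V. U \<in> \<U> \<Longrightarrow> V \<in> \<U> \<Longrightarrow> \<phi> U V \<in> vhom X (?r U V) (res X (x V) (U \<inter> V))"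
    "\<And>U V. U \<in> \<U> \<Longrightarrow> V \<in> \<U> \<Longrightarrow> Comp X (res_arr X (x V) (U \<inter> V)) (\<phi> U V) = Comp X (b U V) (m U V)"
    by metis
  have "gluing_datum X T \<U> x ?r ?a (\<lambda>U V. Comp X (res_arr X (x V) (U \<inter> V)) (\<phi> U V))"
    unfolding gluing_datum_def
  proof (intro conjI ballI allI impI)
    fix U V assume UV: "U \<in> \<U>" "V \<in> \<U>"
    show "Comp X (res_arr X (x V) (U \<inter> V)) (\<phi> U V) \<in> ihom X (?r U V) (x V)"
      unfolding \<phi>(2)[OF UV] by (rule ihom_Comp[OF vhom_ihom[OF m(1)[OF UV]] b[OF UV]])
  next
    fix U V W t f g h
    assume UVW: "U \<in> \<U>" "V \<in> \<U>" "W \<in> \<U>" and t: "pObj X t = subtopology T (U \<inter> V \<inter> W)"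
      and f: "f \<in> ihom X t (?r U V)" and g: "g \<in> ihom X t (?r V W)" and h: "h \<in> ihom X t (?r U W)"
      and fh: "Comp X (?a U V) f = Comp X (?a U W) h"
      and fg: "Comp X (Comp X (res_arr X (x V) (U \<inter> V)) (\<phi> U V)) f = Comp X (?a V W) g"
    note UV = UVW(1,2) and VW = UVW(2,3) and UW = UVW(1,3)
    have as: "Comp X (Comp X k (m U' V')) l = Comp X k (Comp X (m U' V') l)"
      if "U' \<in> \<U>" "V' \<in> \<U>" "k \<in> ihom X (w U' V') y" "l \<in> ihom X t (?r U' V')" for U' V' k l y
      using Comp_assoc[OF ihom_hom[OF that(4)] vhom_hom[OF m(1)[OF that(1,2)]] ihom_hom[OF that(3)]]
      by simp
    \<comment> \<open>Composition with \<open>m\<close> turns a test triple for the chosen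
      restrictions into one for the given spans.\<close>
    have "Comp X (b V W) (Comp X (m V W) g) = Comp X (b U W) (Comp X (m U W) h)"
    proof (rule coc[OF UVW t])
      show "Comp X (m U V) f \<in> ihom X t (w U V)" "Comp X (m V W) g \<in> ihom X t (w V W)"
        "Comp X (m U W) h \<in> ihom X t (w U W)"
        using f g h m(1) UVW by (auto intro: ihom_Comp vhom_ihom)
      show "Comp X (a U V) (Comp X (m U V) f) = Comp X (a U W) (Comp X (m U W) h)"
        using fh as[OF UV a[OF UV] f] as[OF UW a[OF UW] h] m(2) UVW by simp
      show "Comp X (b U V) (Comp X (m U V) f) = Comp X (a V W) (Comp X (m V W) g)"
        using fg as[OF UV b[OF UV] f] as[OF VW a[OF VW] g] m(2)[OF VW] \<phi>(2)[OF UV] by simp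
    qed
    then show "Comp X (Comp X (res_arr X (x W) (V \<inter> W)) (\<phi> V W)) g =
       Comp X (Comp X (res_arr X (x W) (U \<inter> W)) (\<phi> U W)) h"
      unfolding \<phi>(2)[OF VW] \<phi>(2)[OF UW] as[OF VW b[OF VW] g] as[OF UW b[OF UW] h] .
  qed (use x ra po in auto)
  then have "descent_datum X T \<U> x \<phi>"
    using descent_datum_iff[of \<U> x T \<phi>] x \<phi>(1) by blast
  then have "gluing_effective X T \<U> x ?a (\<lambda>U V. Comp X (res_arr X (x V) (U \<inter> V)) (\<phi> U V))"
    using descent_effective[OF cover] effective_iff[of \<U> T x \<phi>] x \<phi>(1) open_cover_subset[OF cover]
    by blast
  then obtain z \<zeta> where z: "z \<in> Obj X" "pObj X z = T" and \<zeta>: "\<And>U. U \<in> \<U> \<Longrightarrow> \<zeta> U \<in> ihom X (x U) z"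
      and e: "\<And>U V. U \<in> \<U> \<Longrightarrow> V \<in> \<U> \<Longrightarrow> Comp X (\<zeta> U) (?a U V) =
        Comp X (\<zeta> V) (Comp X (res_arr X (x V) (U \<inter> V)) (\<phi> U V))"
    unfolding gluing_effective_def by blast
  have "Comp X (\<zeta> U) (a U V) = Comp X (\<zeta> V) (b U V)" if UV: "U \<in> \<U>" "V \<in> \<U>" for U V
  proof (rule vhom_cancel_right[OF m(1)[OF UV]])
    note ah = ihom_hom[OF a[OF UV]] and bh = ihom_hom[OF b[OF UV]] and \<zeta>h = ihom_hom[OF \<zeta>]
    show "Comp X (\<zeta> U) (a U V) \<in> hom X (w U V) z" "Comp X (\<zeta> V) (b U V) \<in> hom X (w U V) z"
      using Comp_in[OF ah \<zeta>h[OF UV(1)]] Comp_in[OF bh \<zeta>h[OF UV(2)]] by auto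
    show "Comp X (Comp X (\<zeta> U) (a U V)) (m U V) = Comp X (Comp X (\<zeta> V) (b U V)) (m U V)"
      using e[OF UV] m(2)[OF UV] \<phi>(2)[OF UV] Comp_assoc[OF vhom_hom[OF m(1)[OF UV]] ah \<zeta>h[OF UV(1)]]
        Comp_assoc[OF vhom_hom[OF m(1)[OF UV]] bh \<zeta>h[OF UV(2)]] by simp
  qed
  then show ?thesis unfolding gluing_effective_def using z \<zeta> by blast
qed

subsection \<open>The loop stack is a stack\<close>

lemma pObj_loop_stack: "pObj (loop_stack X) s = pObj X (fst s)"
  and pMap_loop_stack: "pMap (loop_stack X) m = pMap X (fst (snd m))"
  and Id_loop_stack: "Id (loop_stack X) s = (s, Id X (fst s), s)"
  and Comp_loop_stack: "Comp (loop_stack X) n m =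
    (fst m, Comp X (fst (snd n)) (fst (snd m)), snd (snd n))"
  by (auto simp: loop_stack_def Let_def split: prod.splits)

lemma Obj_loop_stack: "s \<in> Obj (loop_stack X) \<longleftrightarrow> fst s \<in> Obj X \<and> snd s \<in> viso X (fst s) (fst s)"
  by (auto simp: loop_stack_def Let_def)

lemma hom_loop_stack: "m \<in> hom (loop_stack X) s t \<longleftrightarrow>
    s \<in> Obj (loop_stack X) \<and> t \<in> Obj (loop_stack X) \<and> (\<exists>k. m = (s, k, t) \<and>
      k \<in> hom X (fst s) (fst t) \<and> Comp X (snd t) k = Comp X k (snd s))"
  by (auto simp: hom_def loop_stack_def Let_def)

lemma ihom_loop_stack: "m \<in> ihom (loop_stack X) s t \<longleftrightarrow>
    s \<in> Obj (loop_stack X) \<and> t \<in> Obj (loop_stack X) \<and> (\<exists>k. m = (s, k, t) \<and>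
      k \<in> ihom X (fst s) (fst t) \<and> Comp X (snd t) k = Comp X k (snd s))"
  by (auto simp: ihom_def hom_loop_stack pObj_loop_stack pMap_loop_stack)

lemma vhom_loop_stack: "m \<in> vhom (loop_stack X) s t \<longleftrightarrow>
    s \<in> Obj (loop_stack X) \<and> t \<in> Obj (loop_stack X) \<and> (\<exists>k. m = (s, k, t) \<and>
      k \<in> vhom X (fst s) (fst t) \<and> Comp X (snd t) k = Comp X k (snd s))"
  by (auto simp: vhom_iff_ihom ihom_loop_stack pObj_loop_stack)

lemmas loop_stack_simps = pObj_loop_stack pMap_loop_stack Id_loop_stack Comp_loop_stack

section \<open>Pulling back automorphisms; the loop stack is fibred in groupoids\<close>

context fibred_in_groupoids
begin

lemma snd_loop:
  assumes "s \<in> Obj (loop_stack X)"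
  shows "snd s \<in> vhom X (fst s) (fst s)" "snd s \<in> hom X (fst s) (fst s)" "fst s \<in> Obj X"
  using assms by (auto simp: Obj_loop_stack viso_eq_vhom vhom_hom)

lemma category_over_spaces_loop_stack: "category_over_spaces (loop_stack X)"
proof
  fix s t k
  show "k \<in> Arr (loop_stack X) \<Longrightarrow> Dom (loop_stack X) k \<in> Obj (loop_stack X)"
    "k \<in> Arr (loop_stack X) \<Longrightarrow> Cod (loop_stack X) k \<in> Obj (loop_stack X)"
    by (auto simp: loop_stack_def Let_def)
next
  fix s assume s: "s \<in> Obj (loop_stack X)"
  show "Id (loop_stack X) s \<in> hom (loop_stack X) s s"
    using s snd_loop[OF s] by (auto simp: hom_loop_stack loop_stack_simps Id_in Comp_Id_left Comp_Id_right)
  show "pMap (loop_stack X) (Id (loop_stack X) s) = idmap (pObj (loop_stack X) s)"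
    using snd_loop[OF s] by (auto simp: loop_stack_simps pMap_Id)
next
  fix f g s t v assume f: "f \<in> hom (loop_stack X) s t" and g: "g \<in> hom (loop_stack X) t v"
  obtain k where k: "f = (s, k, t)" "k \<in> hom X (fst s) (fst t)" "Comp X (snd t) k = Comp X k (snd s)"
    and s: "s \<in> Obj (loop_stack X)" using f by (auto simp: hom_loop_stack)
  obtain l where l: "g = (t, l, v)" "l \<in> hom X (fst t) (fst v)" "Comp X (snd v) l = Comp X l (snd t)"
    and t: "t \<in> Obj (loop_stack X)" and v: "v \<in> Obj (loop_stack X)" using g by (auto simp: hom_loop_stack)
  note as = snd_loop(2)[OF s] snd_loop(2)[OF t] snd_loop(2)[OF v]
  have "Comp X (snd v) (Comp X l k) = Comp X (Comp X l k) (snd s)"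
    using Comp_assoc[OF k(2) l(2) as(3)] Comp_assoc[OF k(2) as(2) l(2)] Comp_assoc[OF as(1) k(2) l(2)]
      k(3) l(3) by simp
  then show "Comp (loop_stack X) g f \<in> hom (loop_stack X) s v"
    using Comp_in[OF k(2) l(2)] s v by (simp add: hom_loop_stack loop_stack_simps k(1) l(1))
  show "pMap (loop_stack X) (Comp (loop_stack X) g f) =
    compose (topspace (pObj (loop_stack X) s)) (pMap (loop_stack X) g) (pMap (loop_stack X) f)"
    using pMap_Comp[OF k(2) l(2)] by (simp add: loop_stack_simps k(1) l(1))
qed (auto simp: hom_loop_stack loop_stack_simps Comp_Id_left Comp_Id_right pMap_in intro: Comp_assoc)

text \<open>\<open>\<omega>\<close> is the automorphism \<open>snd s\<close> pulled back along
  \<open>k\<close>: following \<open>k\<close> by a vertical arrow does not change the base map, so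
  the composite lifts through \<open>k\<close>. Any object with an arrow into a loop thereby becomes
  a loop.\<close>

lemma loop_lift:
  assumes "s \<in> Obj (loop_stack X)" "k \<in> hom X w (fst s)"
  obtains \<omega> where "(w, \<omega>) \<in> Obj (loop_stack X)" "Comp X (snd s) k = Comp X k \<omega>"
proof -
  note a = snd_loop[OF assms(1)]
  obtain \<omega> where "\<omega> \<in> vhom X w w" "Comp X k \<omega> = Comp X (snd s) k"
    using vhom_lift[OF Comp_in[OF assms(2) a(2)] assms(2)] pMap_Comp_vhom_left[OF assms(2) a(1)] by auto
  then show ?thesis
    using that hom_Obj(1)[OF assms(2)] by (auto simp: Obj_loop_stack viso_eq_vhom)
qed

text \<open>Compatibility of \<open>l\<close> with the automorphisms can be tested after composing
  with the cartesian arrow \<open>k\<close>, since both sides lie over the same map.\<close>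

lemma loop_factor:
  assumes w: "w \<in> Obj (loop_stack X)" and s: "s \<in> Obj (loop_stack X)" and t: "t \<in> Obj (loop_stack X)"
    and k: "k \<in> hom X (fst s) (fst t)" "Comp X (snd t) k = Comp X k (snd s)"
    and l: "l \<in> hom X (fst w) (fst s)"
    and kl: "Comp X (snd t) (Comp X k l) = Comp X (Comp X k l) (snd w)"
  shows "Comp X (snd s) l = Comp X l (snd w)"
proof (rule hom_cancel)
  note a = snd_loop[OF w] and b = snd_loop[OF s] and c = snd_loop[OF t]
  show "Comp X (snd s) l \<in> hom X (fst w) (fst s)" "Comp X l (snd w) \<in> hom X (fst w) (fst s)"
    using Comp_in[OF l b(2)] Comp_in[OF a(2) l] by auto
  show "k \<in> hom X (fst s) (fst t)" by fact
  show "pMap X (Comp X (snd s) l) = pMap X (Comp X l (snd w))"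
    using pMap_Comp_vhom_left[OF l b(1)] pMap_Comp_vhom_right[OF a(1) l] by simp
  show "Comp X k (Comp X (snd s) l) = Comp X k (Comp X l (snd w))"
    using Comp_assoc[OF l b(2) k(1)] Comp_assoc[OF l k(1) c(2)] Comp_assoc[OF a(2) l k(1)] k(2) kl by simp
qed

lemma fibred_in_groupoids_loop_stack: "fibred_in_groupoids (loop_stack X)"
proof -
  interpret L: category_over_spaces "loop_stack X" by (rule category_over_spaces_loop_stack)
  show ?thesis
  proof
    fix s f S assume s: "s \<in> Obj (loop_stack X)" and "f \<in> cmap S (pObj (loop_stack X) s)"
    then obtain x k where k: "k \<in> hom X x (fst s)" "pObj X x = S" "pMap X k = f"
      using lift_ex[of "fst s" f S] snd_loop[OF s] by (auto simp: loop_stack_simps)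
    obtain \<omega> where "(x, \<omega>) \<in> Obj (loop_stack X)" "Comp X (snd s) k = Comp X k \<omega>"
      using loop_lift[OF s k(1)] .
    then show "\<exists>x k. k \<in> hom (loop_stack X) x s \<and> pObj (loop_stack X) x = S \<and> pMap (loop_stack X) k = f"
      using k s by (intro exI[of _ "(x, \<omega>)"] exI[of _ "((x, \<omega>), k, s)"])
        (auto simp: hom_loop_stack loop_stack_simps)
  next
    fix m n x y z f
    assume m: "m \<in> hom (loop_stack X) x z" and n: "n \<in> hom (loop_stack X) y z"
      and f: "f \<in> cmap (pObj (loop_stack X) x) (pObj (loop_stack X) y)"
      and mn: "pMap (loop_stack X) m = compose (topspace (pObj (loop_stack X) x)) (pMap (loop_stack X) n) f"
    obtain k where k: "m = (x, k, z)" "k \<in> hom X (fst x) (fst z)" "Comp X (snd z) k = Comp X k (snd x)"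
      and x: "x \<in> Obj (loop_stack X)" using m by (auto simp: hom_loop_stack)
    obtain l where l: "n = (y, l, z)" "l \<in> hom X (fst y) (fst z)" "Comp X (snd z) l = Comp X l (snd y)"
      and y: "y \<in> Obj (loop_stack X)" and z: "z \<in> Obj (loop_stack X)" using n by (auto simp: hom_loop_stack)
    have "\<exists>!h. h \<in> hom X (fst x) (fst y) \<and> pMap X h = f \<and> Comp X l h = k"
      by (rule lift_unique[OF k(2) l(2)]) (use f mn in \<open>auto simp: loop_stack_simps k(1) l(1)\<close>)
    then obtain h where h: "h \<in> hom X (fst x) (fst y)" "pMap X h = f" "Comp X l h = k"
      and u: "\<And>h'. h' \<in> hom X (fst x) (fst y) \<Longrightarrow> pMap X h' = f \<Longrightarrow> Comp X l h' = k \<Longrightarrow> h' = h" by blast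
    have "Comp X (snd y) h = Comp X h (snd x)"
      by (rule loop_factor[OF x y z l(2,3) h(1)]) (simp add: h(3) k(3))
    then have "(x, h, y) \<in> hom (loop_stack X) x y \<and> pMap (loop_stack X) (x, h, y) = f \<and>
      Comp (loop_stack X) n (x, h, y) = m"
      using h x y by (simp add: hom_loop_stack loop_stack_simps k(1) l(1))
    moreover have "g = (x, h, y)" if g: "g \<in> hom (loop_stack X) x y \<and> pMap (loop_stack X) g = f \<and>
      Comp (loop_stack X) n g = m" for g
    proof -
      obtain h' where h': "g = (x, h', y)" "h' \<in> hom X (fst x) (fst y)"
        using g unfolding hom_loop_stack by blast
      then show ?thesis using g u[of h'] by (simp add: loop_stack_simps k(1) l(1))
    qed
    ultimately show "\<exists>!h. h \<in> hom (loop_stack X) x y \<and> pMap (loop_stack X) h = f \<and>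
      Comp (loop_stack X) n h = m" by (rule ex1I)
  qed
qed

text \<open>The separation half of gluing: the restrictions of \<open>k\<close> form a compatible
  family, which both \<open>k\<close> and \<open>k'\<close> glue.\<close>

lemma glues_arrows_unique:
  assumes "glues_arrows X" "open_cover T \<U>" "pObj X x = T" "k \<in> vhom X x y" "k' \<in> vhom X x y"
    and \<rho>: "\<And>U. U \<in> \<U> \<Longrightarrow> \<rho> U \<in> ihom X (u U) x" "\<And>U. U \<in> \<U> \<Longrightarrow> pObj X (u U) = subtopology T U"
    and e: "\<And>U. U \<in> \<U> \<Longrightarrow> Comp X k (\<rho> U) = Comp X k' (\<rho> U)"
  shows "k = k'"
proof -
  have kh: "k \<in> hom X x y" using assms(4) by (rule vhom_hom)
  have "\<exists>!h. h \<in> vhom X x y \<and> (\<forall>U\<in>\<U>. Comp X h (\<rho> U) = Comp X k (\<rho> U))"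
  proof (rule assms(1)[unfolded glues_arrows_def, rule_format, OF assms(2)])
    show "x \<in> Obj X" "y \<in> Obj X" "pObj X x = T" "pObj X y = T"
      using assms(3,4) hom_Obj[OF kh] by (auto simp: vhom_def)
    show "pObj X (u U) = subtopology T U \<and> \<rho> U \<in> ihom X (u U) x \<and> Comp X k (\<rho> U) \<in> ihom X (u U) y"
      if "U \<in> \<U>" for U using \<rho>[OF that] ihom_Comp[OF \<rho>(1)[OF that] vhom_ihom[OF assms(4)]] by blast
    show "Comp X (Comp X k (\<rho> U)) a = Comp X (Comp X k (\<rho> V)) b"
      if "U \<in> \<U>" "V \<in> \<U>" "a \<in> ihom X w (u U)" "b \<in> ihom X w (u V)"
        "Comp X (\<rho> U) a = Comp X (\<rho> V) b" for U V w a b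
      using Comp_assoc[OF ihom_hom[OF that(3)] ihom_hom[OF \<rho>(1)[OF that(1)]] kh]
        Comp_assoc[OF ihom_hom[OF that(4)] ihom_hom[OF \<rho>(1)[OF that(2)]] kh] that(5) by simp
  qed
  then show ?thesis using assms(4,5) e by metis
qed

end

context stack
begin

text \<open>The arrows are glued in \<open>X\<close>. That the result commutes with the
  automorphisms is an equation of vertical arrows, so it can be checked on the cover.\<close>

lemma glues_arrows_loop_stack: "glues_arrows (loop_stack X)"
  unfolding glues_arrows_def
proof (intro allI impI)
  fix T \<U> s t u \<rho> \<psi>
  let ?L = "loop_stack X"
  assume cover: "open_cover T \<U>" and st: "s \<in> Obj ?L" "t \<in> Obj ?L" "pObj ?L s = T" "pObj ?L t = T"
    and u: "\<forall>U\<in>\<U>. pObj ?L (u U) = subtopology T U \<and> \<rho> U \<in> ihom ?L (u U) s \<and> \<psi> U \<in> ihom ?L (u U) t"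
    and compat: "\<forall>U\<in>\<U>. \<forall>V\<in>\<U>. \<forall>w. \<forall>a\<in>ihom ?L w (u U). \<forall>b\<in>ihom ?L w (u V).
      pObj ?L w = subtopology T (U \<inter> V) \<longrightarrow>
        Comp ?L (\<rho> U) a = Comp ?L (\<rho> V) b \<longrightarrow> Comp ?L (\<psi> U) a = Comp ?L (\<psi> V) b"
  define r where "r U = fst (snd (\<rho> U))" for U
  define p where "p U = fst (snd (\<psi> U))" for U
  have r: "\<rho> U = (u U, r U, s)" "r U \<in> ihom X (fst (u U)) (fst s)"
      "Comp X (snd s) (r U) = Comp X (r U) (snd (u U))"
    and p: "\<psi> U = (u U, p U, t)" "p U \<in> ihom X (fst (u U)) (fst t)"
      "Comp X (snd t) (p U) = Comp X (p U) (snd (u U))"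
    and uo: "pObj X (fst (u U)) = subtopology T U" "u U \<in> Obj ?L"
    if "U \<in> \<U>" for U
    using u that by (auto simp: ihom_loop_stack r_def p_def loop_stack_simps)
  have po: "pObj X (fst s) = T" "pObj X (fst t) = T" using st by (auto simp: loop_stack_simps)
  note s = snd_loop[OF st(1)] and t = snd_loop[OF st(2)]
  have ex: "\<exists>!k. k \<in> vhom X (fst s) (fst t) \<and> (\<forall>U\<in>\<U>. Comp X k (r U) = p U)"
  proof (rule glues_arrows[unfolded glues_arrows_def, rule_format, OF cover s(3) t(3) po])
    show "pObj X (fst (u U)) = subtopology T U \<and> r U \<in> ihom X (fst (u U)) (fst s) \<and>
      p U \<in> ihom X (fst (u U)) (fst t)" if "U \<in> \<U>" for U
      using that r p uo by blast
    fix U V w a b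
    assume UV: "U \<in> \<U>" "V \<in> \<U>" and a: "a \<in> ihom X w (fst (u U))" and b: "b \<in> ihom X w (fst (u V))"
      and w: "pObj X w = subtopology T (U \<inter> V)" and ab: "Comp X (r U) a = Comp X (r V) b"
    \<comment> \<open>The compatibility hypothesis speaks of loops only, so the test object receives
      the automorphism pulled back along \<open>a\<close>. As \<open>a\<close> and \<open>b\<close>
      agree in \<open>s\<close>, \<open>loop_factor\<close> shows that \<open>b\<close> respects it
      as well.\<close>
    obtain \<omega> where \<omega>: "(w, \<omega>) \<in> Obj ?L" "Comp X (snd (u U)) a = Comp X a \<omega>"
      using loop_lift[OF uo(2)[OF UV(1)] ihom_hom[OF a]] .
    note rU = ihom_hom[OF r(2)[OF UV(1)]] and ah = ihom_hom[OF a]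
    have "Comp X (snd s) (Comp X (r U) a) = Comp X (Comp X (r U) a) \<omega>"
      using Comp_assoc[OF ah rU s(2)] Comp_assoc[OF ah snd_loop(2)[OF uo(2)[OF UV(1)]] rU]
        Comp_assoc[OF snd_loop(2)[OF \<omega>(1)] _ rU, simplified, OF ah] r(3)[OF UV(1)] \<omega>(2) by simp
    then have "Comp X (snd (u V)) b = Comp X b \<omega>"
      using loop_factor[OF \<omega>(1) uo(2)[OF UV(2)] st(1) ihom_hom[OF r(2)[OF UV(2)]] r(3)[OF UV(2)]] b
      by (simp add: ab ihom_hom)
    then have "((w, \<omega>), a, u U) \<in> ihom ?L (w, \<omega>) (u U)" "((w, \<omega>), b, u V) \<in> ihom ?L (w, \<omega>) (u V)"
      using \<omega> a b uo UV by (auto simp: ihom_loop_stack)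
    with compat UV w have "Comp ?L (\<rho> U) ((w, \<omega>), a, u U) = Comp ?L (\<rho> V) ((w, \<omega>), b, u V) \<longrightarrow>
      Comp ?L (\<psi> U) ((w, \<omega>), a, u U) = Comp ?L (\<psi> V) ((w, \<omega>), b, u V)"
      by (fastforce simp: pObj_loop_stack)
    then show "Comp X (p U) a = Comp X (p V) b"
      using ab UV by (simp add: Comp_loop_stack r(1) p(1))
  qed
  then obtain k where k: "k \<in> vhom X (fst s) (fst t)" "\<And>U. U \<in> \<U> \<Longrightarrow> Comp X k (r U) = p U" by blast
  note kh = vhom_hom[OF k(1)]
  have "Comp X (snd t) k = Comp X k (snd s)"
  proof (rule glues_arrows_unique[OF glues_arrows cover po(1) Comp_vhom[OF k(1) t(1)] Comp_vhom[OF s(1) k(1)]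
        r(2) uo(1)])
    fix U assume U: "U \<in> \<U>"
    note rU = ihom_hom[OF r(2)[OF U]]
    show "Comp X (Comp X (snd t) k) (r U) = Comp X (Comp X k (snd s)) (r U)"
      using Comp_assoc[OF rU kh t(2)] Comp_assoc[OF rU s(2) kh]
        Comp_assoc[OF snd_loop(2)[OF uo(2)[OF U]] rU kh] k(2)[OF U] r(3)[OF U] p(3)[OF U] by simp
  qed
  then have "(s, k, t) \<in> vhom ?L s t \<and> (\<forall>U\<in>\<U>. Comp ?L (s, k, t) (\<rho> U) = \<psi> U)"
    using k st r(1) p(1) by (simp add: vhom_loop_stack Comp_loop_stack)
  moreover have "m = (s, k, t)" if m: "m \<in> vhom ?L s t \<and> (\<forall>U\<in>\<U>. Comp ?L m (\<rho> U) = \<psi> U)" for m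
  proof -
    obtain k' where k': "m = (s, k', t)" "k' \<in> vhom X (fst s) (fst t)" using m by (auto simp: vhom_loop_stack)
    moreover have "Comp X k' (r U) = p U" if "U \<in> \<U>" for U
      using m that r(1)[OF that] p(1)[OF that] by (auto simp: Comp_loop_stack k'(1))
    ultimately show ?thesis using ex k by blast
  qed
  ultimately show "\<exists>!m. m \<in> vhom ?L s t \<and> (\<forall>U\<in>\<U>. Comp ?L m (\<rho> U) = \<psi> U)" by (rule ex1I)
qed

text \<open>The underlying objects glue to some \<open>z\<close> in \<open>X\<close>; the
  automorphisms of the pieces, carried along the arrows into \<open>z\<close>, then glue to one of
  \<open>z\<close>.\<close>

lemma gluing_effective_loop_stack:
  assumes cover: "open_cover T \<U>" and d: "gluing_datum (loop_stack X) T \<U> x w a b"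
  shows "gluing_effective (loop_stack X) T \<U> x a b"
proof -
  let ?L = "loop_stack X"
  have x: "\<And>U. U \<in> \<U> \<Longrightarrow> x U \<in> Obj ?L" "\<And>U. U \<in> \<U> \<Longrightarrow> pObj X (fst (x U)) = subtopology T U"
    and w: "\<And>U V. U \<in> \<U> \<Longrightarrow> V \<in> \<U> \<Longrightarrow> pObj X (fst (w U V)) = subtopology T (U \<inter> V)"
    and a: "\<And>U V. U \<in> \<U> \<Longrightarrow> V \<in> \<U> \<Longrightarrow> a U V \<in> ihom ?L (w U V) (x U)"
    and b: "\<And>U V. U \<in> \<U> \<Longrightarrow> V \<in> \<U> \<Longrightarrow> b U V \<in> ihom ?L (w U V) (x V)"
    and coc: "\<And>U V W t f g h. U \<in> \<U> \<Longrightarrow> V \<in> \<U> \<Longrightarrow> W \<in> \<U> \<Longrightarrow>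
        pObj ?L t = subtopology T (U \<inter> V \<inter> W) \<Longrightarrow>
        f \<in> ihom ?L t (w U V) \<Longrightarrow> g \<in> ihom ?L t (w V W) \<Longrightarrow> h \<in> ihom ?L t (w U W) \<Longrightarrow>
        Comp ?L (a U V) f = Comp ?L (a U W) h \<Longrightarrow> Comp ?L (b U V) f = Comp ?L (a V W) g \<Longrightarrow>
        Comp ?L (b V W) g = Comp ?L (b U W) h"
    using d unfolding gluing_datum_def pObj_loop_stack by blast+
  define A where "A U V = fst (snd (a U V))" for U V
  define B where "B U V = fst (snd (b U V))" for U V
  have A: "a U V = (w U V, A U V, x U)" "A U V \<in> ihom X (fst (w U V)) (fst (x U))"
      "Comp X (snd (x U)) (A U V) = Comp X (A U V) (snd (w U V))"
    and B: "b U V = (w U V, B U V, x V)" "B U V \<in> ihom X (fst (w U V)) (fst (x V))"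
      "Comp X (snd (x V)) (B U V) = Comp X (B U V) (snd (w U V))"
    and wo: "w U V \<in> Obj ?L"
    if "U \<in> \<U>" "V \<in> \<U>" for U V
    using a[OF that] b[OF that] by (auto simp: ihom_loop_stack A_def B_def)
  have push: "Comp X (snd v) (Comp X k f) = Comp X (Comp X k f) (snd t)"
    if "t \<in> Obj ?L" "s \<in> Obj ?L" "v \<in> Obj ?L" "k \<in> ihom X (fst s) (fst v)" "f \<in> ihom X (fst t) (fst s)"
      "Comp X (snd v) k = Comp X k (snd s)" "Comp X (snd s) f = Comp X f (snd t)" for s t v k f
    using Comp_assoc[OF ihom_hom[OF that(5)] ihom_hom[OF that(4)] snd_loop(2)[OF that(3)]]
      Comp_assoc[OF ihom_hom[OF that(5)] snd_loop(2)[OF that(2)] ihom_hom[OF that(4)]]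
      Comp_assoc[OF snd_loop(2)[OF that(1)] ihom_hom[OF that(5)] ihom_hom[OF that(4)]] that(6,7) by simp
  have "gluing_datum X T \<U> (\<lambda>U. fst (x U)) (\<lambda>U V. fst (w U V)) A B"
    unfolding gluing_datum_def
  proof (intro conjI ballI allI impI)
    fix U V W t f g h
    assume UVW: "U \<in> \<U>" "V \<in> \<U>" "W \<in> \<U>" and t: "pObj X t = subtopology T (U \<inter> V \<inter> W)"
      and f: "f \<in> ihom X t (fst (w U V))" and g: "g \<in> ihom X t (fst (w V W))"
      and h: "h \<in> ihom X t (fst (w U W))"
      and fh: "Comp X (A U V) f = Comp X (A U W) h" and fg: "Comp X (B U V) f = Comp X (A V W) g"
    note UV = UVW(1,2) and VW = UVW(2,3) and UW = UVW(1,3)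
    \<comment> \<open>The cocycle condition is known for loops only. With the automorphism pulled
      back along \<open>f\<close>, the arrows \<open>h\<close> and \<open>g\<close> become arrows of
      loops, because \<open>h\<close> matches \<open>f\<close> in \<open>x U\<close> and
      \<open>g\<close> matches it in \<open>x V\<close>.\<close>
    obtain \<omega> where \<omega>: "(t, \<omega>) \<in> Obj ?L" "Comp X (snd (w U V)) f = Comp X f \<omega>"
      using loop_lift[OF wo[OF UV] ihom_hom[OF f]] .
    have "Comp X (snd (w U W)) h = Comp X h \<omega>"
      using loop_factor[OF \<omega>(1) wo[OF UW] x(1)[OF UVW(1)] ihom_hom[OF A(2)[OF UW]] A(3)[OF UW], of h]
        push[OF \<omega>(1) wo[OF UV] x(1)[OF UVW(1)] A(2)[OF UV] _ A(3)[OF UV], of f] f h \<omega>(2)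
      by (simp add: fh ihom_hom)
    moreover have "Comp X (snd (w V W)) g = Comp X g \<omega>"
      using loop_factor[OF \<omega>(1) wo[OF VW] x(1)[OF UVW(2)] ihom_hom[OF A(2)[OF VW]] A(3)[OF VW], of g]
        push[OF \<omega>(1) wo[OF UV] x(1)[OF UVW(2)] B(2)[OF UV] _ B(3)[OF UV], of f] f g \<omega>(2)
      by (simp add: fg ihom_hom)
    ultimately have "Comp ?L (b V W) ((t, \<omega>), g, w V W) = Comp ?L (b U W) ((t, \<omega>), h, w U W)"
      using \<omega> f g h t fh fg wo UVW
      by (intro coc[OF UVW, of "(t, \<omega>)" "((t, \<omega>), f, w U V)"])
         (auto simp: ihom_loop_stack loop_stack_simps A(1) B(1))
    then show "Comp X (B V W) g = Comp X (B U W) h"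
      using UVW by (simp add: Comp_loop_stack B(1))
  qed (use x w A B snd_loop(3) in blast)+
  then have "gluing_effective X T \<U> (\<lambda>U. fst (x U)) A B"
    by (rule gluing_effective[OF cover])
  then obtain z \<zeta> where z: "z \<in> Obj X" "pObj X z = T"
    and \<zeta>: "\<And>U. U \<in> \<U> \<Longrightarrow> \<zeta> U \<in> ihom X (fst (x U)) z"
    and e: "\<And>U V. U \<in> \<U> \<Longrightarrow> V \<in> \<U> \<Longrightarrow> Comp X (\<zeta> U) (A U V) = Comp X (\<zeta> V) (B U V)"
    unfolding gluing_effective_def by blast
  note \<zeta>h = ihom_hom[OF \<zeta>]
  \<comment> \<open>A vertical arrow from \<open>z\<close> to itself is automatically an
    automorphism, so gluing the arrows \<open>Comp X (\<zeta> U) (snd (x U))\<close>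
    suffices.\<close>
  have "\<exists>!k. k \<in> vhom X z z \<and> (\<forall>U\<in>\<U>. Comp X k (\<zeta> U) = Comp X (\<zeta> U) (snd (x U)))"
  proof (rule glues_arrows[unfolded glues_arrows_def, rule_format, OF cover z(1) z(1) z(2) z(2)])
    show "pObj X (fst (x U)) = subtopology T U \<and> \<zeta> U \<in> ihom X (fst (x U)) z \<and>
      Comp X (\<zeta> U) (snd (x U)) \<in> ihom X (fst (x U)) z" if "U \<in> \<U>" for U
      using x[OF that] \<zeta>[OF that] ihom_Comp[OF vhom_ihom[OF snd_loop(1)] \<zeta>[OF that]] by blast
    fix U V v c d
    assume UV: "U \<in> \<U>" "V \<in> \<U>" and c: "c \<in> ihom X v (fst (x U))" and d: "d \<in> ihom X v (fst (x V))"
      and v: "pObj X v = subtopology T (U \<inter> V)" and cd: "Comp X (\<zeta> U) c = Comp X (\<zeta> V) d"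
    note Ah = ihom_hom[OF A(2)[OF UV]] and Bh = ihom_hom[OF B(2)[OF UV]]
    \<comment> \<open>The test object is identified with the apex of the span, whose automorphism is
      intertwined with those of both pieces; hence the two composites into \<open>z\<close>
      agree.\<close>
    obtain m where m: "m \<in> vhom X v (fst (w U V))" "Comp X (A U V) m = c"
      using ihom_lift_vhom[OF c A(2)[OF UV]] v w[OF UV] by auto
    note mh = vhom_hom[OF m(1)]
    have d': "Comp X (B U V) m = d"
      by (rule ihom_cancel[OF ihom_Comp[OF vhom_ihom[OF m(1)] B(2)[OF UV]] d \<zeta>h[OF UV(2)]])
         (use Comp_assoc[OF mh Bh \<zeta>h[OF UV(2)]] Comp_assoc[OF mh Ah \<zeta>h[OF UV(1)]] e[OF UV] m(2) cd in simp)
    let ?\<omega> = "snd (w U V)"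
    note \<omega> = snd_loop(2)[OF wo[OF UV]]
    have *: "Comp X (Comp X (\<zeta> W) (snd (x W))) (Comp X K m) = Comp X (Comp X (\<zeta> W) K) (Comp X ?\<omega> m)"
      if W: "W \<in> \<U>" and K: "K \<in> hom X (fst (w U V)) (fst (x W))"
        and sq: "Comp X (snd (x W)) K = Comp X K ?\<omega>" for K W
    proof -
      note xW = snd_loop(2)[OF x(1)[OF W]]
      have "Comp X (Comp X (\<zeta> W) (snd (x W))) (Comp X K m) = Comp X (\<zeta> W) (Comp X (snd (x W)) (Comp X K m))"
        using Comp_assoc[OF Comp_in[OF mh K] xW \<zeta>h[OF W]] by simp
      also have "\<dots> = Comp X (\<zeta> W) (Comp X K (Comp X ?\<omega> m))"
        using Comp_square[OF sq K xW \<omega> K mh] by simp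
      also have "\<dots> = Comp X (Comp X (\<zeta> W) K) (Comp X ?\<omega> m)"
        by (rule Comp_assoc[OF Comp_in[OF mh \<omega>] K \<zeta>h[OF W]])
      finally show ?thesis .
    qed
    show "Comp X (Comp X (\<zeta> U) (snd (x U))) c = Comp X (Comp X (\<zeta> V) (snd (x V))) d"
      using *[OF UV(1) Ah A(3)[OF UV]] *[OF UV(2) Bh B(3)[OF UV]] e[OF UV] m(2) d' by simp
  qed
  then obtain \<alpha> where \<alpha>: "\<alpha> \<in> vhom X z z" "\<And>U. U \<in> \<U> \<Longrightarrow> Comp X \<alpha> (\<zeta> U) = Comp X (\<zeta> U) (snd (x U))"
    by blast
  have zL: "(z, \<alpha>) \<in> Obj ?L" using z \<alpha>(1) by (simp add: Obj_loop_stack viso_eq_vhom)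
  show ?thesis
    unfolding gluing_effective_def
    by (rule exI[of _ "(z, \<alpha>)"], rule exI[of _ "\<lambda>U. (x U, \<zeta> U, (z, \<alpha>))"])
       (auto simp: ihom_loop_stack loop_stack_simps zL z x \<zeta> \<alpha>(2) A(1) B(1) e)
qed

lemma stack_loop_stack: "stack (loop_stack X)"
proof -
  interpret L: fibred_in_groupoids "loop_stack X" by (rule fibred_in_groupoids_loop_stack)
  show ?thesis
  proof
    fix T \<U> x y \<phi>
    assume "open_cover T \<U>" "x \<in> Obj (loop_stack X)" "y \<in> Obj (loop_stack X)"
      "pObj (loop_stack X) x = T" "pObj (loop_stack X) y = T"
      "\<And>U. U \<in> \<U> \<Longrightarrow> \<phi> U \<in> viso (loop_stack X) (res (loop_stack X) x U) (res (loop_stack X) y U)"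
      "\<And>U V. U \<in> \<U> \<Longrightarrow> V \<in> \<U> \<Longrightarrow> res_iso (loop_stack X) x y (U \<inter> V) U (\<phi> U) =
        res_iso (loop_stack X) x y (U \<inter> V) V (\<phi> V)"
    then show "\<exists>!k. k \<in> viso (loop_stack X) x y \<and>
      (\<forall>U\<in>\<U>. base_change (loop_stack X) (res_arr (loop_stack X) x U) (res_arr (loop_stack X) y U) k = \<phi> U)"
      by (rule L.glues_arrows_imp_iso_sheaf[OF glues_arrows_loop_stack])
  next
    fix T \<U> x \<phi>
    assume cover: "open_cover T \<U>" and d: "descent_datum (loop_stack X) T \<U> x \<phi>"
    have x: "\<And>U. U \<in> \<U> \<Longrightarrow> x U \<in> Obj (loop_stack X)"
      "\<And>U. U \<in> \<U> \<Longrightarrow> pObj (loop_stack X) (x U) = subtopology T U"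
      and p: "\<And>U V. U \<in> \<U> \<Longrightarrow> V \<in> \<U> \<Longrightarrow> \<phi> U V \<in> vhom (loop_stack X)
        (res (loop_stack X) (x U) (U \<inter> V)) (res (loop_stack X) (x V) (U \<inter> V))"
      using d unfolding descent_datum_def L.viso_eq_vhom by blast+
    from d show "effective (loop_stack X) T \<U> x \<phi>"
      using L.descent_datum_iff[of \<U> x T \<phi>, OF x p] L.effective_iff[of \<U> T x \<phi>, OF _ x p]
        open_cover_subset[OF cover] gluing_effective_loop_stack[OF cover] by blast
  qed
qed

end

subsection \<open>Discrete fibrations\<close>

text \<open>Categories fibred in sets: the spaces, and the fibre products of spaces over a stack.\<close>

locale discrete_fibration = category_over_spaces Z
  for Z :: "('o, 'm, 'a) category_over" +
  assumes arr_unique: "k \<in> hom Z x y \<Longrightarrow> l \<in> hom Z x y \<Longrightarrow> pMap Z k = pMap Z l \<Longrightarrow> k = l"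
    and src_unique: "k \<in> hom Z x z \<Longrightarrow> l \<in> hom Z y z \<Longrightarrow> pObj Z x = pObj Z y \<Longrightarrow>
      pMap Z k = pMap Z l \<Longrightarrow> x = y"
    and arr_ex: "z \<in> Obj Z \<Longrightarrow> f \<in> cmap S (pObj Z z) \<Longrightarrow>
      \<exists>x k. k \<in> hom Z x z \<and> pObj Z x = S \<and> pMap Z k = f"
begin

text \<open>\<open>k\<close> and the identity of \<open>y\<close> lift the same map to the same
  target, hence have the same source.\<close>

lemma vhom_eq: "k \<in> vhom Z x y \<Longrightarrow> x = y"
  using src_unique[of k x y "Id Z y" y] hom_Obj(2)[of k x y] Id_in[of y] pMap_Id[of y]
  by (simp add: vhom_def)

end

lemma is_mapD:
  assumes "is_map X Y F"
  shows "x \<in> Obj X \<Longrightarrow> onObj F x \<in> Obj Y" "x \<in> Obj X \<Longrightarrow> pObj Y (onObj F x) = pObj X x"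
    "x \<in> Obj X \<Longrightarrow> onArr F (Id X x) = Id Y (onObj F x)"
    "k \<in> hom X x y \<Longrightarrow> onArr F k \<in> hom Y (onObj F x) (onObj F y)"
    "k \<in> hom X x y \<Longrightarrow> pMap Y (onArr F k) = pMap X k"
    "k \<in> hom X x y \<Longrightarrow> l \<in> hom X y z \<Longrightarrow> onArr F (Comp X l k) = Comp Y (onArr F l) (onArr F k)"
  using assms unfolding is_map_def by blast+

lemma is_map_comp_map:
  assumes "is_map X Y F" "is_map Y Z G"
  shows "is_map X Z (comp_map G F)"
proof -
  note F = is_mapD[OF assms(1)] and G = is_mapD[OF assms(2)]
  show ?thesis
    unfolding is_map_def comp_map_def
  proof (intro conjI ballI allI)
    fix x y z f g assume f: "f \<in> hom X x y" and g: "g \<in> hom X y z"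
    show "onArr \<lparr>onObj = onObj G \<circ> onObj F, onArr = onArr G \<circ> onArr F\<rparr> (Comp X g f) =
       Comp Z (onArr \<lparr>onObj = onObj G \<circ> onObj F, onArr = onArr G \<circ> onArr F\<rparr> g)
        (onArr \<lparr>onObj = onObj G \<circ> onObj F, onArr = onArr G \<circ> onArr F\<rparr> f)"
      using F(6)[OF f g] G(6)[OF F(4)[OF f] F(4)[OF g]] by simp
  qed (simp_all add: F(1-3) G(1-3) G(4)[OF F(4)] G(5)[OF F(4)] F(5))
qed

text \<open>On arrows, the inverse lifts \<open>pMap Z k\<close> to \<open>Y\<close>, with target
  the preimage of the target of \<open>k\<close>. The image of this lift under \<open>E\<close> ends
  where \<open>k\<close> ends and lies over the same map, so it also starts where \<open>k\<close>
  starts.\<close>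

lemma discrete_inverse_map:
  assumes "discrete_fibration Y" "discrete_fibration Z" and E: "is_map Y Z E"
    and bij: "bij_betw (onObj E) (Obj Y) (Obj Z)"
  shows "\<exists>G. is_map Z Y G \<and> (\<forall>y\<in>Obj Y. onObj G (onObj E y) = y) \<and>
    (\<forall>z\<in>Obj Z. onObj E (onObj G z) = z)"
proof -
  interpret Y: discrete_fibration Y by fact
  interpret Z: discrete_fibration Z by fact
  note E = is_mapD[OF E]
  define g where "g = inv_into (Obj Y) (onObj E)"
  have gE: "g (onObj E y) = y" if "y \<in> Obj Y" for y
    using bij that by (simp add: g_def bij_betw_inv_into_left)
  have Eg: "onObj E (g z) = z" and gO: "g z \<in> Obj Y" if "z \<in> Obj Z" for z
    using bij that by (auto simp: g_def bij_betw_inv_into_right bij_betwE[OF bij_betw_inv_into])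
  have gp: "pObj Y (g z) = pObj Z z" if "z \<in> Obj Z" for z
    using E(2)[OF gO[OF that]] Eg[OF that] by simp
  \<comment> \<open>By \<open>arr_unique\<close> there is at most one candidate, and functoriality
    reduces to comparing base maps.\<close>
  define a where "a k = (SOME h. h \<in> hom Y (g (Dom Z k)) (g (Cod Z k)) \<and> pMap Y h = pMap Z k)" for k
  have a: "a k \<in> hom Y (g x) (g z) \<and> pMap Y (a k) = pMap Z k" if k: "k \<in> hom Z x z" for k x z
  proof -
    note xz = Z.hom_Obj[OF k]
    obtain x' h where h: "h \<in> hom Y x' (g z)" "pObj Y x' = pObj Z x" "pMap Y h = pMap Z k"
      using Y.arr_ex[OF gO[OF xz(2)], of "pMap Z k" "pObj Z x"] Z.pMap_in[OF k] gp[OF xz(2)] by auto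
    note x' = Y.hom_Obj(1)[OF h(1)]
    have "onObj E x' = x"
      using Z.src_unique[OF _ k, of "onArr E h" "onObj E x'"] E(4)[OF h(1)] E(5)[OF h(1)] E(2)[OF x'] h
        Eg[OF xz(2)] by simp
    then have "x' = g x" using gE[OF x'] by simp
    then have "\<exists>h. h \<in> hom Y (g (Dom Z k)) (g (Cod Z k)) \<and> pMap Y h = pMap Z k"
      using h k by (auto simp: hom_def)
    from someI_ex[OF this] show ?thesis unfolding a_def using k by (simp add: hom_def)
  qed
  have "is_map Z Y \<lparr>onObj = g, onArr = a\<rparr>"
    unfolding is_map_def
  proof (intro conjI ballI allI)
    fix z assume z: "z \<in> Obj Z"
    show "onObj \<lparr>onObj = g, onArr = a\<rparr> z \<in> Obj Y"
      "pObj Y (onObj \<lparr>onObj = g, onArr = a\<rparr> z) = pObj Z z" using z by (simp_all add: gO gp)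
    have "a (Id Z z) = Id Y (g z)"
      using a[OF Z.Id_in[OF z]] Y.Id_in[OF gO[OF z]] Y.pMap_Id[OF gO[OF z]] Z.pMap_Id[OF z] gp[OF z]
      by (intro Y.arr_unique) auto
    then show "onArr \<lparr>onObj = g, onArr = a\<rparr> (Id Z z) = Id Y (onObj \<lparr>onObj = g, onArr = a\<rparr> z)" by simp
  next
    fix x y k assume "k \<in> hom Z x y"
    then show "onArr \<lparr>onObj = g, onArr = a\<rparr> k \<in> hom Y (onObj \<lparr>onObj = g, onArr = a\<rparr> x)
        (onObj \<lparr>onObj = g, onArr = a\<rparr> y)"
      "pMap Y (onArr \<lparr>onObj = g, onArr = a\<rparr> k) = pMap Z k" using a by auto
  next
    fix x y z k l assume k: "k \<in> hom Z x y" and l: "l \<in> hom Z y z"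
    note ak = a[OF k] and al = a[OF l] and akl = a[OF Z.Comp_in[OF k l]]
    have "a (Comp Z l k) = Comp Y (a l) (a k)"
    proof (rule Y.arr_unique)
      show "a (Comp Z l k) \<in> hom Y (g x) (g z)" using akl by blast
      show "Comp Y (a l) (a k) \<in> hom Y (g x) (g z)" using ak al by (auto intro: Y.Comp_in)
      show "pMap Y (a (Comp Z l k)) = pMap Y (Comp Y (a l) (a k))"
        using akl Y.pMap_Comp[of "a k" "g x" "g y" "a l" "g z"] Z.pMap_Comp[OF k l] ak al
          gp[OF Z.hom_Obj(1)[OF k]] by simp
    qed
    then show "onArr \<lparr>onObj = g, onArr = a\<rparr> (Comp Z l k) =
      Comp Y (onArr \<lparr>onObj = g, onArr = a\<rparr> l) (onArr \<lparr>onObj = g, onArr = a\<rparr> k)" by simp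
  qed
  then show ?thesis using gE Eg by (intro exI[of _ "\<lparr>onObj = g, onArr = a\<rparr>"]) simp
qed

lemma discrete_2iso:
  assumes "discrete_fibration Y" and F: "is_map Y Y F" "\<And>y. y \<in> Obj Y \<Longrightarrow> onObj F y = y"
  shows "is_2iso Y Y F id_map (Id Y)"
  unfolding is_2iso_def
proof (intro conjI ballI allI)
  interpret Y: discrete_fibration Y by fact
  fix y assume "y \<in> Obj Y"
  then show "Id Y y \<in> viso Y (onObj F y) (onObj id_map y)"
    using F(2) by (simp add: id_map_def Y.Id_viso)
next
  interpret Y: discrete_fibration Y by fact
  fix x y k assume k: "k \<in> hom Y x y"
  note xy = Y.hom_Obj[OF k]
  have Fk: "onArr F k \<in> hom Y x y" using is_mapD(4)[OF F(1) k] F(2) xy by simp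
  have "onArr F k = k" by (rule Y.arr_unique[OF Fk k is_mapD(5)[OF F(1) k]])
  then show "Comp Y (Id Y y) (onArr F k) = Comp Y (onArr id_map k) (Id Y x)"
    using Y.Comp_Id_left[OF k] Y.Comp_Id_right[OF k] by (simp add: id_map_def)
qed

text \<open>Since vertical arrows have equal ends, the 2-isomorphisms of an equivalence make the two
  maps strictly inverse on objects. Conversely, a bijection on objects has a strict inverse, with
  identities as 2-isomorphisms.\<close>

lemma discrete_equivalence_iff:
  assumes YZ: "discrete_fibration Y" "discrete_fibration Z"
  shows "is_equivalence Y Z E \<longleftrightarrow> is_map Y Z E \<and> bij_betw (onObj E) (Obj Y) (Obj Z)"
proof (intro iffI conjI)
  interpret Y: discrete_fibration Y by fact
  interpret Z: discrete_fibration Z by fact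
  assume eq: "is_equivalence Y Z E"
  then show E: "is_map Y Z E" by (simp add: is_equivalence_def)
  obtain G \<eta> \<epsilon> where G: "is_map Z Y G" and \<eta>: "is_2iso Y Y (comp_map G E) id_map \<eta>"
    and \<epsilon>: "is_2iso Z Z (comp_map E G) id_map \<epsilon>"
    using eq by (auto simp: is_equivalence_def)
  have GE: "onObj G (onObj E y) = y" if "y \<in> Obj Y" for y
    using \<eta> that by (intro Y.vhom_eq[of "\<eta> y"]) (auto simp: is_2iso_def viso_def comp_map_def id_map_def)
  have EG: "onObj E (onObj G z) = z" if "z \<in> Obj Z" for z
    using \<epsilon> that by (intro Z.vhom_eq[of "\<epsilon> z"]) (auto simp: is_2iso_def viso_def comp_map_def id_map_def)
  show "bij_betw (onObj E) (Obj Y) (Obj Z)"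
    by (rule bij_betw_byWitness[of _ "onObj G"]) (use GE EG is_mapD(1)[OF E] is_mapD(1)[OF G] in auto)
next
  assume "is_map Y Z E \<and> bij_betw (onObj E) (Obj Y) (Obj Z)"
  then have E: "is_map Y Z E" and bij: "bij_betw (onObj E) (Obj Y) (Obj Z)" by auto
  obtain G where G: "is_map Z Y G" "\<And>y. y \<in> Obj Y \<Longrightarrow> onObj G (onObj E y) = y"
    "\<And>z. z \<in> Obj Z \<Longrightarrow> onObj E (onObj G z) = z"
    using discrete_inverse_map[OF YZ E bij] by blast
  have "is_2iso Y Y (comp_map G E) id_map (Id Y)"
    by (rule discrete_2iso[OF YZ(1) is_map_comp_map[OF E G(1)]]) (simp add: comp_map_def G(2))
  moreover have "is_2iso Z Z (comp_map E G) id_map (Id Z)"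
    by (rule discrete_2iso[OF YZ(2) is_map_comp_map[OF G(1) E]]) (simp add: comp_map_def G(3))
  ultimately show "is_equivalence Y Z E"
    using E G(1) unfolding is_equivalence_def by blast
qed

subsection \<open>Spaces and fibre products\<close>

lemma pObj_yoneda: "pObj (yoneda T) = fst"
  and pMap_yoneda: "pMap (yoneda T) m = fst (snd m)"
  and Id_yoneda: "Id (yoneda T) s = (s, idmap (fst s), s)"
  and Comp_yoneda: "Comp (yoneda T) n m =
    (fst m, compose (topspace (fst (fst m))) (fst (snd n)) (fst (snd m)), snd (snd n))"
  and Obj_yoneda: "s \<in> Obj (yoneda T) \<longleftrightarrow> snd s \<in> cmap (fst s) T"
  by (auto simp: yoneda_def split: prod.splits)

lemmas yoneda_simps = pObj_yoneda pMap_yoneda Id_yoneda Comp_yoneda Obj_yoneda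

lemma hom_yoneda: "m \<in> hom (yoneda T) s t \<longleftrightarrow>
    s \<in> Obj (yoneda T) \<and> t \<in> Obj (yoneda T) \<and> (\<exists>f. m = (s, f, t) \<and>
      f \<in> cmap (fst s) (fst t) \<and> snd s = compose (topspace (fst s)) (snd t) f)"
  by (auto simp: hom_def yoneda_def)

lemma discrete_fibration_yoneda: "discrete_fibration (yoneda T)"
proof
  fix k assume "k \<in> Arr (yoneda T)"
  then show "Dom (yoneda T) k \<in> Obj (yoneda T)" "Cod (yoneda T) k \<in> Obj (yoneda T)"
    by (auto simp: yoneda_def)
next
  fix s assume "s \<in> Obj (yoneda T)"
  then show "Id (yoneda T) s \<in> hom (yoneda T) s s" "pMap (yoneda T) (Id (yoneda T) s) = idmap (pObj (yoneda T) s)"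
    by (auto simp: hom_yoneda yoneda_simps idmap_cmap compose_idmap_right)
next
  fix f g x y z assume "f \<in> hom (yoneda T) x y" "g \<in> hom (yoneda T) y z"
  then show "Comp (yoneda T) g f \<in> hom (yoneda T) x z"
    "pMap (yoneda T) (Comp (yoneda T) g f) =
      compose (topspace (pObj (yoneda T) x)) (pMap (yoneda T) g) (pMap (yoneda T) f)"
    by (auto simp: hom_yoneda yoneda_simps compose_cmap compose_cmap_assoc)
next
  fix z f S assume z: "z \<in> Obj (yoneda T)" and f: "f \<in> cmap S (pObj (yoneda T) z)"
  let ?x = "(S, compose (topspace S) (snd z) f)"
  have "(?x, f, z) \<in> hom (yoneda T) ?x z"
    using z f by (simp add: hom_yoneda Obj_yoneda pObj_yoneda compose_cmap)
  then show "\<exists>x k. k \<in> hom (yoneda T) x z \<and> pObj (yoneda T) x = S \<and> pMap (yoneda T) k = f"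
    by (intro exI[of _ ?x] exI[of _ "(?x, f, z)"]) (simp add: yoneda_simps)
qed (auto simp: hom_yoneda yoneda_simps compose_idmap_left compose_idmap_right compose_cmap_assoc prod_eq_iff)

lemma pObj_fibre_product: "pObj (fibre_product X Y F Z G) s = pObj Y (fst s)"
  and pMap_fibre_product: "pMap (fibre_product X Y F Z G) m = pMap Y (fst (fst (snd m)))"
  and Id_fibre_product: "Id (fibre_product X Y F Z G) s = (s, (Id Y (fst s), Id Z (fst (snd s))), s)"
  and Comp_fibre_product: "Comp (fibre_product X Y F Z G) n m =
    (fst m, (Comp Y (fst (fst (snd n))) (fst (fst (snd m))),
      Comp Z (snd (fst (snd n))) (snd (fst (snd m)))), snd (snd n))"
  and Obj_fibre_product: "s \<in> Obj (fibre_product X Y F Z G) \<longleftrightarrow>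
    fst s \<in> Obj Y \<and> fst (snd s) \<in> Obj Z \<and> pObj Y (fst s) = pObj Z (fst (snd s)) \<and>
    snd (snd s) \<in> viso X (onObj F (fst s)) (onObj G (fst (snd s)))"
  by (auto simp: fibre_product_def Let_def split: prod.splits)

lemmas fibre_product_simps = pObj_fibre_product pMap_fibre_product Id_fibre_product Comp_fibre_product

lemma hom_fibre_product: "m \<in> hom (fibre_product X Y F Z G) s t \<longleftrightarrow>
    s \<in> Obj (fibre_product X Y F Z G) \<and> t \<in> Obj (fibre_product X Y F Z G) \<and> (\<exists>h k. m = (s, (h, k), t) \<and>
      h \<in> hom Y (fst s) (fst t) \<and> k \<in> hom Z (fst (snd s)) (fst (snd t)) \<and> pMap Y h = pMap Z k \<and>
      Comp X (onArr G k) (snd (snd s)) = Comp X (snd (snd t)) (onArr F h))"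
  by (auto simp: hom_def fibre_product_def Let_def)

text \<open>The components in \<open>Y\<close> and \<open>Z\<close> are rigid by assumption. The
  isomorphism in \<open>X\<close> at the source of an arrow is determined by the one at its target,
  because \<open>onArr G k\<close> is cartesian; \<open>vhom_lift\<close> provides it when pulling
  back.\<close>

lemma (in fibred_in_groupoids) discrete_fibration_fibre_product:
  assumes YZ: "discrete_fibration Y" "discrete_fibration Z" and F: "is_map Y X F" and G: "is_map Z X G"
  shows "discrete_fibration (fibre_product X Y F Z G)" (is "discrete_fibration ?P")
proof -
  interpret Y: discrete_fibration Y by fact
  interpret Z: discrete_fibration Z by fact
  note F = is_mapD[OF F] and G = is_mapD[OF G]
  show ?thesis
  proof
    fix k assume "k \<in> Arr ?P"
    then show "Dom ?P k \<in> Obj ?P" "Cod ?P k \<in> Obj ?P"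
      by (auto simp: fibre_product_def Let_def)
  next
    fix s assume s: "s \<in> Obj ?P"
    then have y: "fst s \<in> Obj Y" and z: "fst (snd s) \<in> Obj Z" and "pObj Y (fst s) = pObj Z (fst (snd s))"
      and "snd (snd s) \<in> hom X (onObj F (fst s)) (onObj G (fst (snd s)))"
      by (auto simp: Obj_fibre_product viso_eq_vhom vhom_hom)
    then show "Id ?P s \<in> hom ?P s s" "pMap ?P (Id ?P s) = idmap (pObj ?P s)"
      using s by (simp_all add: hom_fibre_product fibre_product_simps Y.Id_in Z.Id_in Y.pMap_Id Z.pMap_Id
          F(3)[OF y] G(3)[OF z] Comp_Id_left Comp_Id_right)
  next
    fix m n s t v assume m: "m \<in> hom ?P s t" and n: "n \<in> hom ?P t v"
    obtain h k where m': "m = (s, (h, k), t)" and s: "s \<in> Obj ?P" and t: "t \<in> Obj ?P"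
      and h: "h \<in> hom Y (fst s) (fst t)" and k: "k \<in> hom Z (fst (snd s)) (fst (snd t))"
      and hk: "pMap Y h = pMap Z k" and e: "Comp X (onArr G k) (snd (snd s)) = Comp X (snd (snd t)) (onArr F h)"
      using m by (auto simp: hom_fibre_product)
    obtain h' k' where n': "n = (t, (h', k'), v)" and v: "v \<in> Obj ?P"
      and h': "h' \<in> hom Y (fst t) (fst v)" and k': "k' \<in> hom Z (fst (snd t)) (fst (snd v))"
      and hk': "pMap Y h' = pMap Z k'"
      and e': "Comp X (onArr G k') (snd (snd t)) = Comp X (snd (snd v)) (onArr F h')"
      using n by (auto simp: hom_fibre_product)
    have c: "snd (snd s) \<in> hom X (onObj F (fst s)) (onObj G (fst (snd s)))"
      "snd (snd t) \<in> hom X (onObj F (fst t)) (onObj G (fst (snd t)))"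
      "snd (snd v) \<in> hom X (onObj F (fst v)) (onObj G (fst (snd v)))" and p: "pObj Y (fst s) = pObj Z (fst (snd s))"
      using s t v by (auto simp: Obj_fibre_product viso_eq_vhom vhom_hom)
    have "Comp X (onArr G (Comp Z k' k)) (snd (snd s)) = Comp X (snd (snd v)) (onArr F (Comp Y h' h))"
      using Comp_assoc[OF c(1) G(4)[OF k] G(4)[OF k']] Comp_assoc[OF F(4)[OF h] c(2) G(4)[OF k']]
        Comp_assoc[OF F(4)[OF h] F(4)[OF h'] c(3)] e e' F(6)[OF h h'] G(6)[OF k k'] by simp
    then show "Comp ?P n m \<in> hom ?P s v"
      using s v Y.Comp_in[OF h h'] Z.Comp_in[OF k k'] Y.pMap_Comp[OF h h'] Z.pMap_Comp[OF k k'] hk hk' p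
      by (simp add: hom_fibre_product Comp_fibre_product m' n')
    show "pMap ?P (Comp ?P n m) = compose (topspace (pObj ?P s)) (pMap ?P n) (pMap ?P m)"
      using Y.pMap_Comp[OF h h'] by (simp add: fibre_product_simps m' n')
  next
    fix m s t assume "m \<in> hom ?P s t"
    then show "pMap ?P m \<in> cmap (pObj ?P s) (pObj ?P t)"
      "Comp ?P m (Id ?P s) = m" "Comp ?P (Id ?P t) m = m"
      by (auto simp: hom_fibre_product fibre_product_simps Y.Comp_Id_left Z.Comp_Id_left
          Y.Comp_Id_right Z.Comp_Id_right dest: Y.pMap_in)
  next
    fix l m n r s t v assume "l \<in> hom ?P r s" "m \<in> hom ?P s t" "n \<in> hom ?P t v"
    then show "Comp ?P n (Comp ?P m l) = Comp ?P (Comp ?P n m) l"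
      by (auto simp: hom_fibre_product fibre_product_simps intro: Y.Comp_assoc Z.Comp_assoc)
  next
    fix m n s t assume "m \<in> hom ?P s t" "n \<in> hom ?P s t" "pMap ?P m = pMap ?P n"
    then show "m = n"
      by (auto simp: hom_fibre_product fibre_product_simps intro: Y.arr_unique Z.arr_unique)
  next
    fix m n s t v assume m: "m \<in> hom ?P s v" and n: "n \<in> hom ?P t v" and p: "pObj ?P s = pObj ?P t"
      and mn: "pMap ?P m = pMap ?P n"
    obtain h k where m': "m = (s, (h, k), v)" and s: "s \<in> Obj ?P" and v: "v \<in> Obj ?P"
      and h: "h \<in> hom Y (fst s) (fst v)" and k: "k \<in> hom Z (fst (snd s)) (fst (snd v))"
      and hk: "pMap Y h = pMap Z k" and e: "Comp X (onArr G k) (snd (snd s)) = Comp X (snd (snd v)) (onArr F h)"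
      using m by (auto simp: hom_fibre_product)
    obtain h' k' where n': "n = (t, (h', k'), v)" and t: "t \<in> Obj ?P"
      and h': "h' \<in> hom Y (fst t) (fst v)" and k': "k' \<in> hom Z (fst (snd t)) (fst (snd v))"
      and hk': "pMap Y h' = pMap Z k'"
      and e': "Comp X (onArr G k') (snd (snd t)) = Comp X (snd (snd v)) (onArr F h')"
      using n by (auto simp: hom_fibre_product)
    have c: "snd (snd s) \<in> vhom X (onObj F (fst s)) (onObj G (fst (snd s)))"
      "snd (snd t) \<in> vhom X (onObj F (fst t)) (onObj G (fst (snd t)))"
      "pObj Y (fst s) = pObj Z (fst (snd s))" "pObj Y (fst t) = pObj Z (fst (snd t))"
      using s t by (auto simp: Obj_fibre_product viso_eq_vhom)
    have 1: "fst s = fst t"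
      using Y.src_unique[OF h h'] p mn by (simp add: fibre_product_simps m' n')
    have 2: "fst (snd s) = fst (snd t)"
      using Z.src_unique[OF k k'] p mn hk hk' c by (simp add: fibre_product_simps m' n')
    have hh': "h = h'" using Y.arr_unique[OF h, of h'] h' mn by (simp add: fibre_product_simps m' n' 1)
    have kk': "k = k'" using Z.arr_unique[OF k, of k'] k' mn hk hk' by (simp add: fibre_product_simps m' n' 2)
    have "snd (snd s) = snd (snd t)"
    proof (rule ihom_cancel[OF vhom_ihom[OF c(1)] _ G(4)[OF k]])
      show "snd (snd t) \<in> ihom X (onObj F (fst s)) (onObj G (fst (snd s)))"
        using vhom_ihom[OF c(2)] by (simp add: 1 2)
      show "Comp X (onArr G k) (snd (snd s)) = Comp X (onArr G k) (snd (snd t))"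
        using e e' by (simp add: hh' kk')
    qed
    then show "s = t" using 1 2 by (simp add: prod_eq_iff)
  next
    fix t f S assume t: "t \<in> Obj ?P" and f: "f \<in> cmap S (pObj ?P t)"
    from t have y: "fst t \<in> Obj Y" and z: "fst (snd t) \<in> Obj Z" and p: "pObj Y (fst t) = pObj Z (fst (snd t))"
      and c: "snd (snd t) \<in> vhom X (onObj F (fst t)) (onObj G (fst (snd t)))"
      by (auto simp: Obj_fibre_product viso_eq_vhom)
    obtain y' h where h: "h \<in> hom Y y' (fst t)" "pObj Y y' = S" "pMap Y h = f"
      using Y.arr_ex[OF y, of f S] f by (auto simp: pObj_fibre_product)
    obtain z' k where k: "k \<in> hom Z z' (fst (snd t))" "pObj Z z' = S" "pMap Z k = f"
      using Z.arr_ex[OF z, of f S] f by (auto simp: pObj_fibre_product p)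
    have po: "pObj X (onObj F y') = pObj X (onObj G z')"
      using F(2)[OF Y.hom_Obj(1)[OF h(1)]] G(2)[OF Z.hom_Obj(1)[OF k(1)]] h(2) k(2) by simp
    have pm: "pMap X (Comp X (snd (snd t)) (onArr F h)) = pMap X (onArr G k)"
      using pMap_Comp_vhom_left[OF F(4)[OF h(1)] c] F(5)[OF h(1)] G(5)[OF k(1)] h(3) k(3) by simp
    obtain c' where c': "c' \<in> vhom X (onObj F y') (onObj G z')"
      "Comp X (onArr G k) c' = Comp X (snd (snd t)) (onArr F h)"
      using vhom_lift[OF Comp_in[OF F(4)[OF h(1)] vhom_hom[OF c]] G(4)[OF k(1)] po pm] by blast
    have "((y', z', c'), (h, k), t) \<in> hom ?P (y', z', c') t"
      using t h k c' Y.hom_Obj[OF h(1)] Z.hom_Obj[OF k(1)]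
      by (simp add: hom_fibre_product Obj_fibre_product viso_eq_vhom)
    then show "\<exists>s m. m \<in> hom ?P s t \<and> pObj ?P s = S \<and> pMap ?P m = f"
      using h by (intro exI[of _ "(y', z', c')"] exI[of _ "((y', z', c'), (h, k), t)"])
        (simp add: fibre_product_simps)
  qed
qed

subsection \<open>An atlas of the loop stack\<close>

text \<open>The forgetful map from the loop stack to \<open>X\<close>. Composition with it turns a
  test map \<open>T -> LX\<close> into a test map for the given atlas.\<close>

definition loop_base :: "('o \<times> 'm, ('o \<times> 'm) \<times> 'm \<times> ('o \<times> 'm), 'o, 'm) cat_map" where
  "loop_base = \<lparr>onObj = fst, onArr = (\<lambda>m. fst (snd m))\<rparr>"

lemma is_map_loop_base: "is_map (loop_stack X) X loop_base"
  unfolding is_map_def loop_base_def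
  by (auto simp: Obj_loop_stack hom_loop_stack loop_stack_simps)

text \<open>\<open>E\<close> identifies \<open>P\<close> with \<open>A \<times>\<^sub>X A\<close>; a point of \<open>P\<close> at which the two projections to \<open>A\<close> agree
  is a point of \<open>A\<close> together with an automorphism of its image in \<open>X\<close>.\<close>

locale loop_atlas = fibred_in_groupoids X
  for X :: "('o, 'm, 'a) category_over" +
  fixes A :: "'a topology" and F :: "('a yo_obj, 'a yo_arr, 'o, 'm) cat_map"
    and P :: "'a topology" and E
  assumes F: "is_map (yoneda A) X F"
    and E: "is_equivalence (yoneda P) (fibre_product X (yoneda A) F (yoneda A) F) E"
begin

abbreviation AxA where "AxA \<equiv> fibre_product X (yoneda A) F (yoneda A) F"

text \<open>\<open>E\<close> read as the universal property of \<open>P\<close>: a map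
  \<open>c\<close> into \<open>P\<close> amounts to two maps \<open>e1 c\<close>,
  \<open>e2 c\<close> into \<open>A\<close> and an isomorphism \<open>chi c\<close> between their
  images in \<open>X\<close>.\<close>

definition e1 :: "'a yo_obj \<Rightarrow> 'a yo_obj" where "e1 c = fst (onObj E c)"
definition e2 :: "'a yo_obj \<Rightarrow> 'a yo_obj" where "e2 c = fst (snd (onObj E c))"
definition chi :: "'a yo_obj \<Rightarrow> 'm" where "chi c = snd (snd (onObj E c))"
definition e1a :: "'a yo_arr \<Rightarrow> 'a yo_arr" where "e1a m = fst (fst (snd (onArr E m)))"

text \<open>By Yoneda the two projections from \<open>P\<close> to \<open>A\<close> are the values
  of \<open>e1\<close> and \<open>e2\<close> at the identity of \<open>P\<close>, so this is their
  equaliser. As a subspace it stays within the type of points of \<open>P\<close>.\<close>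

definition B :: "'a topology" where
  "B = subtopology P {r. snd (e1 (P, idmap P)) r = snd (e2 (P, idmap P)) r}"

text \<open>In general \<open>chi c\<close> runs from the image of \<open>e1 c\<close> to that of
  \<open>e2 c\<close>; it is an automorphism once \<open>c\<close> factors through
  \<open>B\<close>.\<close>

definition loop_atlas_map ::
  "('a yo_obj, 'a yo_arr, 'o \<times> 'm, ('o \<times> 'm) \<times> 'm \<times> ('o \<times> 'm)) cat_map" where
  "loop_atlas_map = \<lparr>onObj = (\<lambda>c. (onObj F (e1 c), chi c)),
     onArr = (\<lambda>m. ((onObj F (e1 (fst m)), chi (fst m)), onArr F (e1a m),
       (onObj F (e1 (snd (snd m))), chi (snd (snd m)))))\<rparr>"

lemma AxA_discrete: "discrete_fibration AxA"
  by (rule discrete_fibration_fibre_product[OF discrete_fibration_yoneda discrete_fibration_yoneda F F])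

lemma E_map: "is_map (yoneda P) AxA E" and E_bij: "bij_betw (onObj E) (Obj (yoneda P)) (Obj AxA)"
  using E discrete_equivalence_iff[OF discrete_fibration_yoneda AxA_discrete] by auto

lemma e_Obj:
  assumes "c \<in> Obj (yoneda P)"
  shows "e1 c \<in> Obj (yoneda A)" "e2 c \<in> Obj (yoneda A)" "fst (e1 c) = fst c" "fst (e2 c) = fst c"
    "chi c \<in> vhom X (onObj F (e1 c)) (onObj F (e2 c))"
  using is_mapD(1,2)[OF E_map assms]
  by (auto simp: Obj_fibre_product pObj_fibre_product pObj_yoneda viso_eq_vhom e1_def e2_def chi_def)

lemma e_hom:
  assumes "m \<in> hom (yoneda P) c d"
  obtains k where "onArr E m = (onObj E c, (e1a m, k), onObj E d)"
    "e1a m \<in> hom (yoneda A) (e1 c) (e1 d)" "k \<in> hom (yoneda A) (e2 c) (e2 d)"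
    "pMap (yoneda A) (e1a m) = pMap (yoneda P) m" "pMap (yoneda A) k = pMap (yoneda P) m"
    "Comp X (onArr F k) (chi c) = Comp X (chi d) (onArr F (e1a m))"
  using is_mapD(4,5)[OF E_map assms] that
  by (auto simp: hom_fibre_product pMap_fibre_product e1_def e2_def chi_def e1a_def)

text \<open>The map \<open>c\<close> is itself an arrow from \<open>c\<close> to the identity of
  \<open>P\<close>; the action of \<open>E\<close> on this arrow gives both formulas.\<close>

lemma e_eq:
  assumes c: "c \<in> Obj (yoneda P)"
  shows "e1 c = (fst c, compose (topspace (fst c)) (snd (e1 (P, idmap P))) (snd c))"
    "e2 c = (fst c, compose (topspace (fst c)) (snd (e2 (P, idmap P))) (snd c))"
proof -
  have m: "(c, snd c, (P, idmap P)) \<in> hom (yoneda P) c (P, idmap P)"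
    using c by (simp add: hom_yoneda Obj_yoneda idmap_cmap compose_idmap_left)
  obtain k where k: "e1a (c, snd c, (P, idmap P)) \<in> hom (yoneda A) (e1 c) (e1 (P, idmap P))"
    "k \<in> hom (yoneda A) (e2 c) (e2 (P, idmap P))"
    "pMap (yoneda A) (e1a (c, snd c, (P, idmap P))) = pMap (yoneda P) (c, snd c, (P, idmap P))"
    "pMap (yoneda A) k = pMap (yoneda P) (c, snd c, (P, idmap P))"
    by (rule e_hom[OF m]) (rule that)
  then show "e1 c = (fst c, compose (topspace (fst c)) (snd (e1 (P, idmap P))) (snd c))"
    "e2 c = (fst c, compose (topspace (fst c)) (snd (e2 (P, idmap P))) (snd c))"
    using e_Obj(3,4)[OF c] by (auto simp: hom_yoneda pMap_yoneda prod_eq_iff)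
qed

text \<open>The universal property of an equaliser: by \<open>e_eq\<close> the composites of
  \<open>c\<close> with the two projections are \<open>e1 c\<close> and \<open>e2 c\<close>.\<close>

lemma Obj_yoneda_B: "c \<in> Obj (yoneda B) \<longleftrightarrow> c \<in> Obj (yoneda P) \<and> e1 c = e2 c"
proof -
  have "c \<in> Obj (yoneda B) \<longleftrightarrow> c \<in> Obj (yoneda P) \<and>
    (\<forall>s\<in>topspace (fst c). snd (e1 (P, idmap P)) (snd c s) = snd (e2 (P, idmap P)) (snd c s))"
    by (auto simp: Obj_yoneda B_def cmap_def continuous_map_in_subtopology image_subset_iff)
  moreover have "(\<forall>s\<in>topspace (fst c). snd (e1 (P, idmap P)) (snd c s) = snd (e2 (P, idmap P)) (snd c s))
      \<longleftrightarrow> e1 c = e2 c" if "c \<in> Obj (yoneda P)"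
    unfolding e_eq[OF that] by (auto simp: compose_def fun_eq_iff restrict_def)
  ultimately show ?thesis by blast
qed

lemma hom_yoneda_B:
  "m \<in> hom (yoneda B) c d \<longleftrightarrow> m \<in> hom (yoneda P) c d \<and> c \<in> Obj (yoneda B) \<and> d \<in> Obj (yoneda B)"
  using Obj_yoneda_B by (auto simp: hom_yoneda)

lemma loop_atlas_map_Obj:
  assumes "c \<in> Obj (yoneda B)"
  shows "(onObj F (e1 c), chi c) \<in> Obj (loop_stack X)"
  using assms e_Obj[of c] is_mapD(1)[OF F] by (simp add: Obj_yoneda_B Obj_loop_stack viso_eq_vhom)

text \<open>Over \<open>B\<close> the two components of \<open>onArr E m\<close> share their ends
  and their base map and so coincide; the square of an arrow in \<open>AxA\<close> then becomes
  commutation with the automorphisms.\<close>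

lemma e1a_hom:
  assumes m: "m \<in> hom (yoneda B) c d"
  shows "e1a m \<in> hom (yoneda A) (e1 c) (e1 d)" "pMap (yoneda A) (e1a m) = pMap (yoneda B) m"
    "Comp X (onArr F (e1a m)) (chi c) = Comp X (chi d) (onArr F (e1a m))"
proof -
  interpret A: discrete_fibration "yoneda A" by (rule discrete_fibration_yoneda)
  obtain k where k: "e1a m \<in> hom (yoneda A) (e1 c) (e1 d)" "k \<in> hom (yoneda A) (e2 c) (e2 d)"
    "pMap (yoneda A) (e1a m) = pMap (yoneda P) m" "pMap (yoneda A) k = pMap (yoneda P) m"
    "Comp X (onArr F k) (chi c) = Comp X (chi d) (onArr F (e1a m))"
    using e_hom m by (metis hom_yoneda_B)
  moreover have "k = e1a m"
    using A.arr_unique[OF k(1), of k] k(2-4) m by (simp add: hom_yoneda_B Obj_yoneda_B)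
  ultimately show "e1a m \<in> hom (yoneda A) (e1 c) (e1 d)" "pMap (yoneda A) (e1a m) = pMap (yoneda B) m"
    "Comp X (onArr F (e1a m)) (chi c) = Comp X (chi d) (onArr F (e1a m))"
    by (auto simp: pMap_yoneda)
qed

lemma e1a_functor:
  shows "c \<in> Obj (yoneda B) \<Longrightarrow> e1a (Id (yoneda B) c) = Id (yoneda A) (e1 c)"
    and "m \<in> hom (yoneda B) c d \<Longrightarrow> n \<in> hom (yoneda B) d e \<Longrightarrow>
      e1a (Comp (yoneda B) n m) = Comp (yoneda A) (e1a n) (e1a m)"
proof -
  show "e1a (Id (yoneda B) c) = Id (yoneda A) (e1 c)" if "c \<in> Obj (yoneda B)"
    using is_mapD(3)[OF E_map, of c] that
    by (simp add: e1a_def e1_def Obj_yoneda_B Id_yoneda Id_fibre_product)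
  show "e1a (Comp (yoneda B) n m) = Comp (yoneda A) (e1a n) (e1a m)"
    if "m \<in> hom (yoneda B) c d" "n \<in> hom (yoneda B) d e"
  proof -
    have "Comp (yoneda B) n m = Comp (yoneda P) n m" by (simp add: Comp_yoneda)
    then show ?thesis
      using is_mapD(6)[OF E_map, of m c d n e] that by (simp add: e1a_def hom_yoneda_B Comp_fibre_product)
  qed
qed

lemma is_map_loop_atlas_map: "is_map (yoneda B) (loop_stack X) loop_atlas_map"
  unfolding is_map_def
proof (intro conjI ballI allI)
  note F = is_mapD[OF F]
  fix c assume c: "c \<in> Obj (yoneda B)"
  then have cP: "c \<in> Obj (yoneda P)" by (simp add: Obj_yoneda_B)
  show "onObj loop_atlas_map c \<in> Obj (loop_stack X)"
    using loop_atlas_map_Obj[OF c] by (simp add: loop_atlas_map_def)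
  show "pObj (loop_stack X) (onObj loop_atlas_map c) = pObj (yoneda B) c"
    using e_Obj[OF cP] F(2) by (simp add: loop_atlas_map_def pObj_loop_stack pObj_yoneda)
  show "onArr loop_atlas_map (Id (yoneda B) c) = Id (loop_stack X) (onObj loop_atlas_map c)"
    using e1a_functor(1)[OF c] F(3)[OF e_Obj(1)[OF cP]]
    by (simp add: loop_atlas_map_def Id_loop_stack) (simp add: Id_yoneda)
next
  note F = is_mapD[OF F]
  fix c d m assume m: "m \<in> hom (yoneda B) c d"
  then have cd: "c \<in> Obj (yoneda B)" "d \<in> Obj (yoneda B)" "fst m = c" "snd (snd m) = d"
    by (auto simp: hom_yoneda)
  show "onArr loop_atlas_map m \<in> hom (loop_stack X) (onObj loop_atlas_map c) (onObj loop_atlas_map d)"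
    using loop_atlas_map_Obj[OF cd(1)] loop_atlas_map_Obj[OF cd(2)] F(4)[OF e1a_hom(1)[OF m]] e1a_hom(3)[OF m]
    by (simp add: loop_atlas_map_def hom_loop_stack cd(3,4))
  show "pMap (loop_stack X) (onArr loop_atlas_map m) = pMap (yoneda B) m"
    using F(5)[OF e1a_hom(1)[OF m]] e1a_hom(2)[OF m] by (simp add: loop_atlas_map_def pMap_loop_stack)
next
  note F = is_mapD[OF F]
  fix c d e m n assume m: "m \<in> hom (yoneda B) c d" and n: "n \<in> hom (yoneda B) d e"
  show "onArr loop_atlas_map (Comp (yoneda B) n m) =
    Comp (loop_stack X) (onArr loop_atlas_map n) (onArr loop_atlas_map m)"
    using e1a_functor(2)[OF m n] F(6)[OF e1a_hom(1)[OF m] e1a_hom(1)[OF n]]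
    by (simp add: loop_atlas_map_def Comp_loop_stack) (simp add: Comp_yoneda)
qed

text \<open>Conjugation with the vertical component of a point of \<open>T \<times>\<^sub>X A\<close> transports the automorphism over
  \<open>T\<close> to the point of \<open>A\<close>, so that \<open>T \<times>\<^sub>L B\<close> and \<open>T \<times>\<^sub>X A\<close> are isomorphic, where \<open>L\<close> is the loop stack.\<close>

definition base_comparison ::
  "('a yo_obj \<times> 'a yo_obj \<times> (('o \<times> 'm) \<times> 'm \<times> ('o \<times> 'm)),
    ('a yo_obj \<times> 'a yo_obj \<times> (('o \<times> 'm) \<times> 'm \<times> ('o \<times> 'm))) \<times> ('a yo_arr \<times> 'a yo_arr) \<times>
      ('a yo_obj \<times> 'a yo_obj \<times> (('o \<times> 'm) \<times> 'm \<times> ('o \<times> 'm))),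
    'a yo_obj \<times> 'a yo_obj \<times> 'm,
    ('a yo_obj \<times> 'a yo_obj \<times> 'm) \<times> ('a yo_arr \<times> 'a yo_arr) \<times> ('a yo_obj \<times> 'a yo_obj \<times> 'm)) cat_map" where
  "base_comparison = \<lparr>onObj = (\<lambda>s. (fst s, e1 (fst (snd s)), fst (snd (snd (snd s))))),
     onArr = (\<lambda>m. ((fst (fst m), e1 (fst (snd (fst m))), fst (snd (snd (snd (fst m))))),
       (fst (fst (snd m)), e1a (snd (fst (snd m)))),
       (fst (snd (snd m)), e1 (fst (snd (snd (snd m)))), fst (snd (snd (snd (snd (snd m))))))))\<rparr>"

lemma base_comparison:
  assumes G: "is_map (yoneda T) (loop_stack X) G"
  defines "L \<equiv> fibre_product (loop_stack X) (yoneda T) G (yoneda B) loop_atlas_map"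
    and "M \<equiv> fibre_product X (yoneda T) (comp_map loop_base G) (yoneda A) F"
  shows "is_map L M base_comparison" "bij_betw (onObj base_comparison) (Obj L) (Obj M)"
proof -
  interpret LX: fibred_in_groupoids "loop_stack X" by (rule fibred_in_groupoids_loop_stack)
  note F' = is_mapD[OF F] and G' = is_mapD[OF G]
  have oL: "s \<in> Obj L \<longleftrightarrow> fst s \<in> Obj (yoneda T) \<and> fst (snd s) \<in> Obj (yoneda B) \<and>
      fst (fst s) = fst (fst (snd s)) \<and> (\<exists>k. snd (snd s) = (onObj G (fst s), k, onObj loop_atlas_map (fst (snd s))) \<and>
        k \<in> vhom X (fst (onObj G (fst s))) (onObj F (e1 (fst (snd s)))) \<and>
        Comp X (chi (fst (snd s))) k = Comp X k (snd (onObj G (fst s))))" for s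
    using G'(1)[of "fst s"] loop_atlas_map_Obj[of "fst (snd s)"]
    by (auto simp: L_def Obj_fibre_product LX.viso_eq_vhom vhom_loop_stack pObj_yoneda loop_atlas_map_def)
  have oM: "s \<in> Obj M \<longleftrightarrow> fst s \<in> Obj (yoneda T) \<and> fst (snd s) \<in> Obj (yoneda A) \<and>
      fst (fst s) = fst (fst (snd s)) \<and>
      snd (snd s) \<in> vhom X (fst (onObj G (fst s))) (onObj F (fst (snd s)))" for s
    by (simp add: M_def Obj_fibre_product viso_eq_vhom pObj_yoneda comp_map_def loop_base_def)
  have im: "onObj base_comparison s \<in> Obj M" if "s \<in> Obj L" for s
    using that e_Obj by (auto simp: oL oM base_comparison_def Obj_yoneda_B)
  show "is_map L M base_comparison"
    unfolding is_map_def
  proof (intro conjI ballI allI)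
    fix s assume s: "s \<in> Obj L"
    show "onObj base_comparison s \<in> Obj M" by (rule im[OF s])
    show "pObj M (onObj base_comparison s) = pObj L s"
      by (simp add: M_def L_def pObj_fibre_product base_comparison_def)
    show "onArr base_comparison (Id L s) = Id M (onObj base_comparison s)"
      using s e1a_functor(1)[of "fst (snd s)"]
      by (simp add: oL M_def) (simp add: L_def Id_fibre_product base_comparison_def Id_yoneda[of T])
  next
    fix s t m assume m: "m \<in> hom L s t"
    obtain h k where m': "m = (s, (h, k), t)" and s: "s \<in> Obj L" and t: "t \<in> Obj L"
      and h: "h \<in> hom (yoneda T) (fst s) (fst t)" and k: "k \<in> hom (yoneda B) (fst (snd s)) (fst (snd t))"
      and hk: "pMap (yoneda T) h = pMap (yoneda B) k"
      and e: "Comp (loop_stack X) (onArr loop_atlas_map k) (snd (snd s)) =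
        Comp (loop_stack X) (snd (snd t)) (onArr G h)"
      using m by (auto simp: L_def hom_fibre_product)
    have "Comp X (onArr F (e1a k)) (fst (snd (snd (snd s)))) =
      Comp X (fst (snd (snd (snd t)))) (fst (snd (onArr G h)))"
      using e by (simp add: Comp_loop_stack loop_atlas_map_def)
    then show "onArr base_comparison m \<in> hom M (onObj base_comparison s) (onObj base_comparison t)"
      using im[OF s] im[OF t] h e1a_hom(1,2)[OF k] hk
      by (simp add: M_def hom_fibre_product base_comparison_def m' comp_map_def loop_base_def)
    show "pMap M (onArr base_comparison m) = pMap L m"
      by (simp add: M_def L_def pMap_fibre_product base_comparison_def)
  next
    fix s t v m n assume "m \<in> hom L s t" "n \<in> hom L t v"
    then have "snd (fst (snd m)) \<in> hom (yoneda B) (fst (snd s)) (fst (snd t))"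
      "snd (fst (snd n)) \<in> hom (yoneda B) (fst (snd t)) (fst (snd v))"
      by (auto simp: L_def hom_fibre_product)
    from e1a_functor(2)[OF this] show "onArr base_comparison (Comp L n m) =
      Comp M (onArr base_comparison n) (onArr base_comparison m)"
      by (simp add: L_def M_def Comp_fibre_product base_comparison_def)
  qed
  \<comment> \<open>As \<open>k\<close> is invertible, the automorphism \<open>chi\<close> at the
    point of \<open>B\<close> is determined by \<open>k\<close> and the automorphism over
    \<open>T\<close>. Together with \<open>e1 = e2\<close> this fixes the image under
    \<open>E\<close>, hence the point.\<close>
  have "inj_on (onObj base_comparison) (Obj L)"
  proof (rule inj_onI)
    fix s t assume s: "s \<in> Obj L" and t: "t \<in> Obj L" and st: "onObj base_comparison s = onObj base_comparison t"
    obtain k where k: "snd (snd s) = (onObj G (fst s), k, onObj loop_atlas_map (fst (snd s)))"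
      "k \<in> vhom X (fst (onObj G (fst s))) (onObj F (e1 (fst (snd s))))"
      "Comp X (chi (fst (snd s))) k = Comp X k (snd (onObj G (fst s)))" using s oL by blast
    obtain l where l: "snd (snd t) = (onObj G (fst t), l, onObj loop_atlas_map (fst (snd t)))"
      "Comp X (chi (fst (snd t))) l = Comp X l (snd (onObj G (fst t)))" using t oL by blast
    have e: "fst s = fst t" "e1 (fst (snd s)) = e1 (fst (snd t))" "k = l"
      using st k(1) l(1) by (auto simp: base_comparison_def)
    have B: "fst (snd s) \<in> Obj (yoneda P)" "fst (snd t) \<in> Obj (yoneda P)"
      "e1 (fst (snd s)) = e2 (fst (snd s))" "e1 (fst (snd t)) = e2 (fst (snd t))"
      using s t by (auto simp: oL Obj_yoneda_B)
    have "chi (fst (snd s)) = chi (fst (snd t))"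
      using vhom_cancel_right[OF k(2) vhom_hom[OF e_Obj(5)[OF B(1)]],
          of "chi (fst (snd t))" "onObj F (e2 (fst (snd t)))"]
        vhom_hom[OF e_Obj(5)[OF B(2)]] k(3) l(2) e by simp
    then have "onObj E (fst (snd s)) = onObj E (fst (snd t))"
      using e(2) B(3,4) by (simp add: e1_def e2_def chi_def prod_eq_iff)
    then have "fst (snd s) = fst (snd t)"
      using E_bij B(1,2) by (meson bij_betw_imp_inj_on inj_onD)
    then have "snd (snd s) = snd (snd t)" using e k(1) l(1) by simp
    with \<open>fst (snd s) = fst (snd t)\<close> e(1) show "s = t"
      by (simp add: prod_eq_iff[of s t] prod_eq_iff[of "snd s" "snd t"])
  qed
  moreover have "\<exists>s\<in>Obj L. onObj base_comparison s = p" if p: "p \<in> Obj M" for p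
  proof -
    obtain t a k where p': "p = (t, a, k)" by (metis surj_pair)
    have t: "t \<in> Obj (yoneda T)" and a: "a \<in> Obj (yoneda A)" and ta: "fst t = fst a"
      and k: "k \<in> vhom X (fst (onObj G t)) (onObj F a)" using p by (auto simp: oM p')
    note g = snd_loop[OF G'(1)[OF t]]
    obtain l where l: "l \<in> vhom X (onObj F a) (fst (onObj G t))" "Comp X l k = Id X (fst (onObj G t))"
      using vhom_inverse[OF k] by metis
    \<comment> \<open>Conjugation by \<open>k\<close>, with \<open>l\<close> as its inverse: the
      only automorphism of \<open>onObj F a\<close> that makes \<open>k\<close> an arrow of
      loops.\<close>
    define \<psi> where "\<psi> = Comp X (Comp X k (snd (onObj G t))) l"
    have kg: "Comp X k (snd (onObj G t)) \<in> vhom X (fst (onObj G t)) (onObj F a)"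
      by (rule Comp_vhom[OF g(1) k])
    have \<psi>: "\<psi> \<in> vhom X (onObj F a) (onObj F a)"
      unfolding \<psi>_def by (rule Comp_vhom[OF l(1) kg])
    have \<psi>k: "Comp X \<psi> k = Comp X k (snd (onObj G t))"
      unfolding \<psi>_def using Comp_assoc[OF vhom_hom[OF k] vhom_hom[OF l(1)] vhom_hom[OF kg]] l(2)
        Comp_Id_right[OF vhom_hom[OF kg]] by simp
    \<comment> \<open>Surjectivity of \<open>E\<close> on objects yields a map \<open>c\<close> into
      \<open>P\<close>; since both components are \<open>a\<close>, it factors through
      \<open>B\<close>.\<close>
    have "(a, a, \<psi>) \<in> Obj AxA" using a \<psi> by (simp add: Obj_fibre_product viso_eq_vhom)
    then have "(a, a, \<psi>) \<in> onObj E ` Obj (yoneda P)"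
      using E_bij by (simp add: bij_betw_def)
    then obtain c where c: "(a, a, \<psi>) = onObj E c" "c \<in> Obj (yoneda P)"
      by (rule imageE)
    have ec: "e1 c = a" "chi c = \<psi>" "e2 c = a"
      unfolding e1_def e2_def chi_def c(1)[symmetric] by simp_all
    have "(t, c, (onObj G t, k, onObj loop_atlas_map c)) \<in> Obj L"
      using t k \<psi>k c(2) e_Obj(3)[OF c(2)] ta by (simp add: oL Obj_yoneda_B ec)
    then show ?thesis by (rule bexI[rotated]) (simp add: base_comparison_def p' ec)
  qed
  then have "onObj base_comparison ` Obj L = Obj M"
    using im by (metis (no_types, lifting) equalityI image_eqI image_subsetI subsetI)
  ultimately show "bij_betw (onObj base_comparison) (Obj L) (Obj M)"
    by (simp add: bij_betw_def)
qed

section \<open>Transfer of the atlas properties along the comparison\<close>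

lemma fibre_products_discrete:
  assumes G: "is_map (yoneda T) (loop_stack X) G"
  shows "discrete_fibration (fibre_product (loop_stack X) (yoneda T) G (yoneda B) loop_atlas_map)"
    "discrete_fibration (fibre_product X (yoneda T) (comp_map loop_base G) (yoneda A) F)"
proof -
  interpret LX: fibred_in_groupoids "loop_stack X" by (rule fibred_in_groupoids_loop_stack)
  show "discrete_fibration (fibre_product (loop_stack X) (yoneda T) G (yoneda B) loop_atlas_map)"
    by (rule LX.discrete_fibration_fibre_product[OF discrete_fibration_yoneda discrete_fibration_yoneda
        G is_map_loop_atlas_map])
  show "discrete_fibration (fibre_product X (yoneda T) (comp_map loop_base G) (yoneda A) F)"
    by (rule discrete_fibration_fibre_product[OF discrete_fibration_yoneda discrete_fibration_yoneda
        is_map_comp_map[OF G is_map_loop_base] F])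
qed

text \<open>The space representing the base change of \<open>A\<close> along
  \<open>T -> LX -> X\<close> also represents that of \<open>B\<close>, by way of the inverse of
  \<open>base_comparison\<close>.\<close>

lemma representable_loop_atlas_map:
  assumes "representable (yoneda A) X F"
  shows "representable (yoneda B) (loop_stack X) loop_atlas_map"
  unfolding representable_def
proof (intro conjI allI impI is_map_loop_atlas_map)
  fix T G assume G: "is_map (yoneda T) (loop_stack X) G"
  let ?L = "fibre_product (loop_stack X) (yoneda T) G (yoneda B) loop_atlas_map"
  let ?M = "fibre_product X (yoneda T) (comp_map loop_base G) (yoneda A) F"
  note d = fibre_products_discrete[OF G]
  obtain Q K where "is_equivalence (yoneda Q) ?M K"
    using assms is_map_comp_map[OF G is_map_loop_base] unfolding representable_def by blast
  then have K: "is_map (yoneda Q) ?M K" "bij_betw (onObj K) (Obj (yoneda Q)) (Obj ?M)"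
    using discrete_equivalence_iff[OF discrete_fibration_yoneda d(2)] by auto
  obtain N where N: "is_map ?M ?L N" "\<And>s. s \<in> Obj ?L \<Longrightarrow> onObj N (onObj base_comparison s) = s"
    "\<And>p. p \<in> Obj ?M \<Longrightarrow> onObj base_comparison (onObj N p) = p"
    using discrete_inverse_map[OF d base_comparison[OF G]] by blast
  have "bij_betw (onObj N) (Obj ?M) (Obj ?L)"
    by (rule bij_betw_byWitness[of _ "onObj base_comparison"])
       (use N(2,3) is_mapD(1)[OF N(1)] is_mapD(1)[OF base_comparison(1)[OF G]] in auto)
  then have "bij_betw (onObj (comp_map N K)) (Obj (yoneda Q)) (Obj ?L)"
    using bij_betw_trans[OF K(2)] by (simp add: comp_map_def)
  then have "is_equivalence (yoneda Q) ?L (comp_map N K)"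
    using discrete_equivalence_iff[OF discrete_fibration_yoneda d(1)] is_map_comp_map[OF K(1) N(1)] by blast
  then show "\<exists>Q K. is_equivalence (yoneda Q) ?L K" by blast
qed

lemma all_base_changes_loop_atlas_map:
  assumes "all_base_changes R (yoneda A) X F"
  shows "all_base_changes R (yoneda B) (loop_stack X) loop_atlas_map"
  unfolding all_base_changes_def
proof (intro allI impI)
  fix T G Q K
  let ?L = "fibre_product (loop_stack X) (yoneda T) G (yoneda B) loop_atlas_map"
  let ?M = "fibre_product X (yoneda T) (comp_map loop_base G) (yoneda A) F"
  assume G: "is_map (yoneda T) (loop_stack X) G" and "is_equivalence (yoneda Q) ?L K"
  note d = fibre_products_discrete[OF G] and c = base_comparison[OF G]
  have K: "is_map (yoneda Q) ?L K" "bij_betw (onObj K) (Obj (yoneda Q)) (Obj ?L)"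
    using \<open>is_equivalence (yoneda Q) ?L K\<close> discrete_equivalence_iff[OF discrete_fibration_yoneda d(1)] by auto
  have "bij_betw (onObj (comp_map base_comparison K)) (Obj (yoneda Q)) (Obj ?M)"
    using bij_betw_trans[OF K(2) c(2)] by (simp add: comp_map_def)
  then have "is_equivalence (yoneda Q) ?M (comp_map base_comparison K)"
    using discrete_equivalence_iff[OF discrete_fibration_yoneda d(2)] is_map_comp_map[OF K(1) c(1)] by blast
  then have "R Q T (space_map Q (comp_map proj1 (comp_map base_comparison K)))"
    using assms is_map_comp_map[OF G is_map_loop_base] unfolding all_base_changes_def by blast
  \<comment> \<open>\<open>base_comparison\<close> keeps the component in \<open>T\<close>, so the
    two space maps are literally the same function.\<close>
  then show "R Q T (space_map Q (comp_map proj1 K))"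
    by (simp add: space_map_def comp_map_def proj1_def base_comparison_def split_beta)
qed

end

theorem lemma2p25:
  fixes X :: "('o, 'm, 'a) category_over"
  assumes "topological_stack X"
  shows "topological_stack (loop_stack X)"
proof -
  interpret stack X using assms by (simp add: topological_stack_def)
  obtain A F where atlas: "is_atlas X A F" using assms by (auto simp: topological_stack_def)
  then have F: "is_map (yoneda A) X F" by (simp add: is_atlas_def representable_def)
  \<comment> \<open>Representability of the atlas is used with the atlas itself as the test map
    \<open>A -> X\<close>.\<close>
  obtain P E where E: "is_equivalence (yoneda P) (fibre_product X (yoneda A) F (yoneda A) F) E"
    using atlas F unfolding is_atlas_def representable_def by blast
  interpret loop_atlas X A F P E by unfold_locales (fact F E)+
  have "is_atlas (loop_stack X) B loop_atlas_map"
    using atlas representable_loop_atlas_map all_base_changes_loop_atlas_map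
    unfolding is_atlas_def by blast
  then show ?thesis using stack_loop_stack unfolding topological_stack_def by blast
qed

end
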